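(* Let $c$ be a natural number and let the energy function be any function computable in polynomial time. Then $k$-charge removal, restricted to instances in which every ion has charge $c$ or $-c$, can be reduced in polynomial time to the max-weight $k$-clique problem.
   Context: A crystal graph has a finite vertex set $V$ of ions; ion $i$ has a position in $\mathbb{R}^3$, a nonzero charge $wt(v_i)$ and a species; the pairwise energy $U_{ij}$ of distinct ions is given by the fixed energy function applied to species-dependent force-field parameters (part of the input) and the Euclidean distance between them. The total energy of $A\subseteq V$ is $\sum_{\{i,j\}\subseteq A,\,i\ne j}U_{ij}$. For $R\subseteq V$, $R^+$ denotes its positively weighted vertices; $R$ is neutral if $\sum_{v_i\in R}wt(v_i)=0$, and a set of $k$-charges if neutral and $\sum_{v_i\in R^+}wt(v_i)=k$. $k$-charge removal asks, given a charge-neutral crystal graph and a natural number $k$ (in the decision version, also a goal $g$), for a set of $k$-charges $R$ minimising the total energy of $V\setminus R$ (resp. whether this energy can be at most $g$). The max-weight $k$-clique (weighted $k$-clique) problem takes as input an edge-weighted graph, a natural number $k'$ and a value $v$, and asks whether there is a clique of size $k'$ whose edge weights sum to at least $v$. *)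

theory Defs
  imports "HOL-Analysis.Analysis" "HOL-Computational_Algebra.Polynomial"
begin

section \<open>Polynomial-time computation\<close>

text \<open>
  The machine model is the language WHILE over binary trees of N. D. Jones (Computability and
  Complexity from a Programming Perspective). Evaluating an expression is charged
  the number of nodes of every intermediate value, not one unit per operation. With this charge
  a run of cost \<open>t\<close> can be simulated by a Turing machine in time polynomial in \<open>t\<close> and the input
  size (and conversely), also for functions whose output is a tree: no value of exponential size
  can be built by sharing.
\<close>

datatype tree = Leaf | Node tree tree

fun tree_size :: "tree \<Rightarrow> nat" where
  "tree_size Leaf = 1"
| "tree_size (Node a b) = 1 + tree_size a + tree_size b"

fun tree_hd :: "tree \<Rightarrow> tree" where
  "tree_hd Leaf = Leaf"
| "tree_hd (Node a b) = a"

fun tree_tl :: "tree \<Rightarrow> tree" where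
  "tree_tl Leaf = Leaf"
| "tree_tl (Node a b) = b"

type_synonym store = "nat \<Rightarrow> tree"

datatype expr = Var nat | NilE | ConsE expr expr | HdE expr | TlE expr

fun expr_val :: "expr \<Rightarrow> store \<Rightarrow> tree" where
  "expr_val (Var x) s = s x"
| "expr_val NilE s = Leaf"
| "expr_val (ConsE e f) s = Node (expr_val e s) (expr_val f s)"
| "expr_val (HdE e) s = tree_hd (expr_val e s)"
| "expr_val (TlE e) s = tree_tl (expr_val e s)"

fun expr_cost :: "expr \<Rightarrow> store \<Rightarrow> nat" where
  "expr_cost (Var x) s = tree_size (s x)"
| "expr_cost NilE s = 1"
| "expr_cost (ConsE e f) s =
     expr_cost e s + expr_cost f s + tree_size (expr_val (ConsE e f) s)"
| "expr_cost (HdE e) s = expr_cost e s + tree_size (expr_val (HdE e) s)"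
| "expr_cost (TlE e) s = expr_cost e s + tree_size (expr_val (TlE e) s)"

datatype com = Assign nat expr | Seq com com | If expr com com | While expr com

text \<open>\<open>exec c s t s'\<close>: from store \<open>s\<close>, the program \<open>c\<close> halts in store \<open>s'\<close> at total cost \<open>t\<close>.
  \<open>Leaf\<close> counts as false in tests, every other tree as true.\<close>

inductive exec :: "com \<Rightarrow> store \<Rightarrow> nat \<Rightarrow> store \<Rightarrow> bool" where
  Assign: "exec (Assign x e) s (expr_cost e s) (s(x := expr_val e s))"
| Seq: "exec c1 s t1 s' \<Longrightarrow> exec c2 s' t2 s'' \<Longrightarrow> exec (Seq c1 c2) s (t1 + t2) s''"
| IfTrue: "expr_val e s \<noteq> Leaf \<Longrightarrow> exec c1 s t s' \<Longrightarrow>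
    exec (If e c1 c2) s (expr_cost e s + t) s'"
| IfFalse: "expr_val e s = Leaf \<Longrightarrow> exec c2 s t s' \<Longrightarrow>
    exec (If e c1 c2) s (expr_cost e s + t) s'"
| WhileFalse: "expr_val e s = Leaf \<Longrightarrow> exec (While e c) s (expr_cost e s) s"
| WhileTrue: "expr_val e s \<noteq> Leaf \<Longrightarrow> exec c s t1 s' \<Longrightarrow> exec (While e c) s' t2 s'' \<Longrightarrow>
    exec (While e c) s (expr_cost e s + t1 + t2) s''"

definition halts_with :: "com \<Rightarrow> tree \<Rightarrow> nat \<Rightarrow> tree \<Rightarrow> bool" where
  "halts_with P d t d' \<longleftrightarrow> (\<exists>s. exec P ((\<lambda>_. Leaf)(0 := d)) t s \<and> s 0 = d')"

text \<open>A coding is a relation between trees and the objects they denote. An object may have several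
  codes (a fraction need not be in lowest terms) or none (an irrational number).\<close>

type_synonym 'a coding = "tree \<Rightarrow> 'a \<Rightarrow> bool"

definition polytime_computable :: "'a coding \<Rightarrow> 'b coding \<Rightarrow> ('a \<Rightarrow> 'b) \<Rightarrow> bool" where
  "polytime_computable A B f \<longleftrightarrow>
     (\<exists>(P :: com) (p :: nat poly). \<forall>d x. A d x \<longrightarrow>
        (\<exists>t d'. halts_with P d t d' \<and> t \<le> poly p (tree_size d) \<and> B d' (f x)))"

record 'a problem =
  coding :: "'a coding"
  instances :: "'a set"
  yes :: "'a \<Rightarrow> bool"

definition restrict_problem :: "'a problem \<Rightarrow> ('a \<Rightarrow> bool) \<Rightarrow> 'a problem" where
  "restrict_problem A Q = A\<lparr>instances := {x \<in> instances A. Q x}\<rparr>"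

definition polytime_reducible :: "'a problem \<Rightarrow> 'b problem \<Rightarrow> bool" where
  "polytime_reducible A B \<longleftrightarrow>
     (\<exists>(P :: com) (p :: nat poly). \<forall>d x. x \<in> instances A \<and> coding A d x \<longrightarrow>
        (\<exists>t d' y. halts_with P d t d' \<and> t \<le> poly p (tree_size d) \<and>
           y \<in> instances B \<and> coding B d' y \<and> (yes A x \<longleftrightarrow> yes B y)))"


section \<open>Codings\<close>

definition bit_tree :: "bool \<Rightarrow> tree" where
  "bit_tree b = (if b then Node Leaf Leaf else Leaf)"

text \<open>Binary, least significant bit first, without leading zeros.\<close>

fun nat_tree :: "nat \<Rightarrow> tree" where
  "nat_tree n = (if n = 0 then Leaf else Node (bit_tree (odd n)) (nat_tree (n div 2)))"

declare nat_tree.simps [simp del]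

definition int_tree :: "int \<Rightarrow> tree" where
  "int_tree i = Node (bit_tree (i < 0)) (nat_tree (nat \<bar>i\<bar>))"

definition nat_code :: "nat coding" where
  "nat_code d n \<longleftrightarrow> d = nat_tree n"

definition real_code :: "real coding" where
  "real_code d x \<longleftrightarrow>
     (\<exists>(a :: int) (b :: nat). b > 0 \<and> d = Node (int_tree a) (nat_tree b) \<and> x = of_int a / of_nat b)"

definition pair_code :: "'a coding \<Rightarrow> 'b coding \<Rightarrow> ('a \<times> 'b) coding" where
  "pair_code A B d z \<longleftrightarrow> (\<exists>a b. d = Node a b \<and> A a (fst z) \<and> B b (snd z))"

fun list_code :: "'a coding \<Rightarrow> 'a list coding" where
  "list_code A d [] \<longleftrightarrow> d = Leaf"
| "list_code A d (x # xs) \<longleftrightarrow> (\<exists>a b. d = Node a b \<and> A a x \<and> list_code A b xs)"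

definition point_code :: "(real ^ 3) coding" where
  "point_code d p \<longleftrightarrow>
     pair_code real_code (pair_code real_code real_code) d (p $ 1, p $ 2, p $ 3)"

text \<open>The distance of two points with rational coordinates is the square root of a rational
  number; it is given exactly by its square.\<close>

definition distance_code :: "real coding" where
  "distance_code d r \<longleftrightarrow> r \<ge> 0 \<and> real_code d (r ^ 2)"


section \<open>Charge removal\<close>

text \<open>\<open>params\<close> gives the force-field parameters of an unordered pair \<open>{s, t}\<close> of (possibly equal)
  species.\<close>

record crystal =
  ions :: "nat set"
  position :: "nat \<Rightarrow> real ^ 3"
  charge :: "nat \<Rightarrow> real"
  species :: "nat \<Rightarrow> nat"
  params :: "nat set \<Rightarrow> real list"

type_synonym energy_function = "real list \<Rightarrow> real \<Rightarrow> real"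

definition pair_energy :: "energy_function \<Rightarrow> crystal \<Rightarrow> nat \<Rightarrow> nat \<Rightarrow> real" where
  "pair_energy F X i j =
     F (params X {species X i, species X j}) (dist (position X i) (position X j))"

definition total_energy :: "energy_function \<Rightarrow> crystal \<Rightarrow> nat set \<Rightarrow> real" where
  "total_energy F X A = (\<Sum>(i, j) \<in> {(i, j). i \<in> A \<and> j \<in> A \<and> i < j}. pair_energy F X i j)"

definition crystal_graph :: "crystal \<Rightarrow> bool" where
  "crystal_graph X \<longleftrightarrow> finite (ions X) \<and> (\<forall>v \<in> ions X. charge X v \<noteq> 0)"

definition positive_part :: "crystal \<Rightarrow> nat set \<Rightarrow> nat set" where
  "positive_part X R = {v \<in> R. charge X v > 0}"

definition neutral :: "crystal \<Rightarrow> nat set \<Rightarrow> bool" where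
  "neutral X R \<longleftrightarrow> (\<Sum>v \<in> R. charge X v) = 0"

definition k_charges :: "crystal \<Rightarrow> nat \<Rightarrow> nat set \<Rightarrow> bool" where
  "k_charges X k R \<longleftrightarrow>
     R \<subseteq> ions X \<and> neutral X R \<and> (\<Sum>v \<in> positive_part X R. charge X v) = real k"

text \<open>A crystal is written as the list of its ions (name, position, charge, species) and a list of
  entries \<open>(s, t, \<theta>)\<close> giving the parameters for every pair of species occurring in a pair of ions.\<close>

definition crystal_code :: "crystal coding" where
  "crystal_code d X \<longleftrightarrow> (\<exists>vs ps.
     pair_code
       (list_code (pair_code nat_code (pair_code point_code (pair_code real_code nat_code))))
       (list_code (pair_code nat_code (pair_code nat_code (list_code real_code))))
       d (vs, ps) \<and>
     distinct (map fst vs) \<and> ions X = set (map fst vs) \<and>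
     (\<forall>(v, p, q, s) \<in> set vs. position X v = p \<and> charge X v = q \<and> species X v = s) \<and>
     (\<forall>(s, t, \<theta>) \<in> set ps. params X {s, t} = \<theta>) \<and>
     (\<forall>i \<in> ions X. \<forall>j \<in> ions X. i \<noteq> j \<longrightarrow>
        (\<exists>(s, t, \<theta>) \<in> set ps. {s, t} = {species X i, species X j})))"

definition charge_removal :: "energy_function \<Rightarrow> (crystal \<times> nat \<times> real) problem" where
  "charge_removal F =
     \<lparr>coding = pair_code crystal_code (pair_code nat_code real_code),
      instances = {(X, k, g). crystal_graph X \<and> neutral X (ions X)},
      yes = (\<lambda>(X, k, g). \<exists>R. k_charges X k R \<and> total_energy F X (ions X - R) \<le> g)\<rparr>"


section \<open>Maximum-weight clique of given size\<close>

record weighted_graph =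
  vertices :: "nat set"
  edges :: "nat set set"
  weight :: "nat set \<Rightarrow> real"

definition graph :: "weighted_graph \<Rightarrow> bool" where
  "graph G \<longleftrightarrow> finite (vertices G) \<and> (\<forall>e \<in> edges G. e \<subseteq> vertices G \<and> card e = 2)"

definition clique :: "weighted_graph \<Rightarrow> nat set \<Rightarrow> bool" where
  "clique G C \<longleftrightarrow> C \<subseteq> vertices G \<and> (\<forall>u \<in> C. \<forall>v \<in> C. u \<noteq> v \<longrightarrow> {u, v} \<in> edges G)"

definition clique_weight :: "weighted_graph \<Rightarrow> nat set \<Rightarrow> real" where
  "clique_weight G C = (\<Sum>e \<in> {e \<in> edges G. e \<subseteq> C}. weight G e)"

definition graph_code :: "weighted_graph coding" where
  "graph_code d G \<longleftrightarrow> (\<exists>vs es.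
     pair_code
       (list_code nat_code)
       (list_code (pair_code nat_code (pair_code nat_code real_code)))
       d (vs, es) \<and>
     distinct vs \<and> vertices G = set vs \<and>
     distinct (map (\<lambda>(u, v, w). {u, v}) es) \<and> edges G = (\<lambda>(u, v, w). {u, v}) ` set es \<and>
     (\<forall>(u, v, w) \<in> set es. weight G {u, v} = w))"

definition max_weight_clique :: "(weighted_graph \<times> nat \<times> real) problem" where
  "max_weight_clique =
     \<lparr>coding = pair_code graph_code (pair_code nat_code real_code),
      instances = {(G, k, v). graph G},
      yes = (\<lambda>(G, k, v). \<exists>C. clique G C \<and> card C = k \<and> clique_weight G C \<ge> v)\<rparr>"

end

theory Submission
  imports Defs
begin

text \<open>
  Keeping \<open>V - R\<close> instead of removing \<open>R\<close>, the task is to choose \<open>r\<close> positive and \<open>r\<close> negative ions of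
  minimal total energy, where \<open>r = |V\<^sup>+| - k / c\<close>. Take the complete graph on the ions with weights
  \<open>- U\<^sub>i\<^sub>j\<close>, and add a bonus \<open>M\<close> to every edge between opposite charges. Among the cliques of size \<open>2 * r\<close>
  the number of such edges is \<open>r\<^sup>2\<close> for the neutral ones and at most \<open>r\<^sup>2 - 1\<close> for the others, so for \<open>M\<close>
  larger than all energies together, weight at least \<open>M * r\<^sup>2 - g\<close> means neutral and of energy at most \<open>g\<close>.
  As \<open>|a / b| \<le> |a|\<close>, the sum of the numerators gives such an \<open>M\<close> of polynomial length.

  As for the running time, the functions computable in polynomial time are closed under composition,
  pairing, case distinction and iteration along a list as long as the intermediate results have
  polynomial size; binary arithmetic is such an iteration over the digits.
\<close>

section \<open>Programs\<close>

text \<open>The energy function is available only as some program that starts from a blank store, is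
  guaranteed to halt only on valid codes, and may answer with any fraction for the value, possibly a
  different one for each code of the same argument. So polynomial time is developed for functions on
  concrete data (numerals, unreduced fractions, lists) over an explicit domain, and these data are
  tied to the real objects they denote by relations. Fractions are never reduced: only a bounded
  number of operations is applied to each, so sizes stay polynomial without a gcd. As the crystal is
  neutral, keeping r ions of each sign is the same as removing k / c of each sign. If k is not a
  multiple of c or exceeds the total positive charge, no set of k-charges exists, and a fixed
  instance without solution is output.\<close>

fun expr_below :: "nat \<Rightarrow> expr \<Rightarrow> bool" where
  "expr_below n (Var x) \<longleftrightarrow> x < n"
| "expr_below n NilE \<longleftrightarrow> True"
| "expr_below n (ConsE e f) \<longleftrightarrow> expr_below n e \<and> expr_below n f"
| "expr_below n (HdE e) \<longleftrightarrow> expr_below n e"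
| "expr_below n (TlE e) \<longleftrightarrow> expr_below n e"

fun com_below :: "nat \<Rightarrow> com \<Rightarrow> bool" where
  "com_below n (Assign x e) \<longleftrightarrow> x < n \<and> expr_below n e"
| "com_below n (Seq c1 c2) \<longleftrightarrow> com_below n c1 \<and> com_below n c2"
| "com_below n (If e c1 c2) \<longleftrightarrow> expr_below n e \<and> com_below n c1 \<and> com_below n c2"
| "com_below n (While e c) \<longleftrightarrow> expr_below n e \<and> com_below n c"

lemma expr_below_mono: "expr_below m e \<Longrightarrow> m \<le> n \<Longrightarrow> expr_below n e"
  by (induction e) auto

lemma com_below_mono: "com_below m c \<Longrightarrow> m \<le> n \<Longrightarrow> com_below n c"
  by (induction c) (auto intro: expr_below_mono)

lemma ex_expr_below: "\<exists>n. expr_below n e"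
proof (induction e)
  case (ConsE e f)
  then obtain m n where "expr_below m e" "expr_below n f" by blast
  then have "expr_below (max m n) (ConsE e f)"
    by (auto intro: expr_below_mono)
  then show ?case ..
qed auto

lemma ex_com_below: "\<exists>n. com_below n c"
proof (induction c)
  case (Assign x e)
  obtain n where "expr_below n e" using ex_expr_below ..
  then have "com_below (max (Suc x) n) (Assign x e)"
    by (auto intro: expr_below_mono)
  then show ?case ..
next
  case (Seq c1 c2)
  then obtain m n where "com_below m c1" "com_below n c2" by blast
  then have "com_below (max m n) (Seq c1 c2)"
    by (auto intro: com_below_mono)
  then show ?case ..
next
  case (If e c1 c2)
  then obtain m n where "com_below m c1" "com_below n c2" by blast
  moreover obtain k where "expr_below k e" using ex_expr_below ..
  ultimately have "com_below (max k (max m n)) (If e c1 c2)"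
    by (auto intro: com_below_mono expr_below_mono)
  then show ?case ..
next
  case (While e c)
  then obtain m where "com_below m c" by blast
  moreover obtain k where "expr_below k e" using ex_expr_below ..
  ultimately have "com_below (max k m) (While e c)"
    by (auto intro: com_below_mono expr_below_mono)
  then show ?case ..
qed

lemma expr_below_cong:
  assumes "expr_below n e" "\<forall>x<n. s x = r x"
  shows "expr_val e s = expr_val e r" "expr_cost e s = expr_cost e r"
proof -
  have "expr_val e s = expr_val e r \<and> expr_cost e s = expr_cost e r"
    using assms by (induction e) auto
  then show "expr_val e s = expr_val e r" "expr_cost e s = expr_cost e r" by auto
qed

text \<open>A program neither reads nor writes variables that do not occur in it. So a program
  specified only on the blank store, such as the one for the energy function, can run while higher
  variables hold data of a surrounding program.\<close>

lemma exec_frame: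
  assumes "exec c s t s'" "com_below n c" "\<forall>x<n. s x = r x"
  shows "\<exists>r'. exec c r t r' \<and> (\<forall>x<n. s' x = r' x) \<and> (\<forall>x\<ge>n. r' x = r x)"
  using assms
proof (induction arbitrary: r rule: exec.induct)
  case (Assign x e s)
  then have "expr_val e s = expr_val e r" "expr_cost e s = expr_cost e r"
    using expr_below_cong[of n e s r] by simp_all
  moreover have "exec (Assign x e) r (expr_cost e r) (r(x := expr_val e r))"
    by (rule exec.Assign)
  ultimately show ?case
    using Assign by (intro exI[of _ "r(x := expr_val e r)"] conjI) (simp_all del: fun_upd_apply, simp_all)
next
  case (Seq c1 s t1 s' c2 t2 s'')
  obtain r1 where r1: "exec c1 r t1 r1" "\<forall>x<n. s' x = r1 x" "\<forall>x\<ge>n. r1 x = r x"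
    using Seq.IH(1)[of r] Seq.prems by auto
  obtain r2 where "exec c2 r1 t2 r2" "\<forall>x<n. s'' x = r2 x" "\<forall>x\<ge>n. r2 x = r1 x"
    using Seq.IH(2)[of r1] Seq.prems r1 by auto
  then show ?case
    using r1 exec.Seq by (intro exI[of _ r2]) auto
next
  case (IfTrue e s c1 t s' c2)
  then have "expr_val e s = expr_val e r" "expr_cost e s = expr_cost e r"
    using expr_below_cong[of n e s r] by simp_all
  moreover obtain r1 where "exec c1 r t r1" "\<forall>x<n. s' x = r1 x" "\<forall>x\<ge>n. r1 x = r x"
    using IfTrue.IH[of r] IfTrue.prems by auto
  ultimately show ?case
    using IfTrue.hyps(1) exec.IfTrue by (intro exI[of _ r1]) auto
next
  case (IfFalse e s c2 t s' c1)
  then have "expr_val e s = expr_val e r" "expr_cost e s = expr_cost e r"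
    using expr_below_cong[of n e s r] by simp_all
  moreover obtain r1 where "exec c2 r t r1" "\<forall>x<n. s' x = r1 x" "\<forall>x\<ge>n. r1 x = r x"
    using IfFalse.IH[of r] IfFalse.prems by auto
  ultimately show ?case
    using IfFalse.hyps(1) exec.IfFalse by (intro exI[of _ r1]) auto
next
  case (WhileFalse e s c)
  then have "expr_val e s = expr_val e r" "expr_cost e s = expr_cost e r"
    using expr_below_cong[of n e s r] by simp_all
  then show ?case
    using WhileFalse exec.WhileFalse[of e r c] by (intro exI[of _ r]) auto
next
  case (WhileTrue e s c t1 s' t2 s'')
  then have "expr_val e s = expr_val e r" "expr_cost e s = expr_cost e r"
    using expr_below_cong[of n e s r] by simp_all
  moreover obtain r1 where r1: "exec c r t1 r1" "\<forall>x<n. s' x = r1 x" "\<forall>x\<ge>n. r1 x = r x"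
    using WhileTrue.IH(1)[of r] WhileTrue.prems by auto
  moreover obtain r2 where "exec (While e c) r1 t2 r2" "\<forall>x<n. s'' x = r2 x" "\<forall>x\<ge>n. r2 x = r1 x"
    using WhileTrue.IH(2)[of r1] WhileTrue.prems r1 by auto
  ultimately show ?case
    using WhileTrue.hyps(1) exec.WhileTrue[of e r c t1 r1 t2 r2] by (intro exI[of _ r2]) auto
qed

section \<open>Sizes and cost bounds of runs\<close>

lemma tree_size_pos: "0 < tree_size d"
  by (cases d) auto

lemma tree_size_le_expr_cost: "tree_size (expr_val e s) \<le> expr_cost e s"
  by (induction e) auto

text \<open>Every value written has been charged its size, so the cost also bounds the growth of
  each variable. This turns polynomial time into polynomial output size, which closure under
  composition rests on.\<close>

lemma exec_tree_size: "exec c s t s' \<Longrightarrow> tree_size (s' x) \<le> tree_size (s x) + t"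
proof (induction rule: exec.induct)
  case (Assign y e s)
  then show ?case using tree_size_le_expr_cost[of e s] by auto
qed auto

text \<open>An upper bound instead of the exact cost, so that budgets of program fragments add up
  and may be weakened.\<close>

definition runs :: "com \<Rightarrow> store \<Rightarrow> nat \<Rightarrow> store \<Rightarrow> bool" where
  "runs c s T s' \<longleftrightarrow> (\<exists>t\<le>T. exec c s t s')"

lemma runs_mono: "runs c s T s' \<Longrightarrow> T \<le> T' \<Longrightarrow> runs c s T' s'"
  unfolding runs_def using le_trans by blast

lemma runs_Assign: "expr_cost e s \<le> T \<Longrightarrow> runs (Assign x e) s T (s(x := expr_val e s))"
  unfolding runs_def using exec.Assign by blast

lemma runs_Seq: "runs c1 s T1 s' \<Longrightarrow> runs c2 s' T2 s'' \<Longrightarrow> runs (Seq c1 c2) s (T1 + T2) s''"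
  unfolding runs_def using exec.Seq add_mono by blast

lemma runs_IfTrue:
  "expr_val e s \<noteq> Leaf \<Longrightarrow> runs c1 s T s' \<Longrightarrow> runs (If e c1 c2) s (expr_cost e s + T) s'"
  unfolding runs_def using exec.IfTrue add_left_mono by blast

lemma runs_IfFalse:
  "expr_val e s = Leaf \<Longrightarrow> runs c2 s T s' \<Longrightarrow> runs (If e c1 c2) s (expr_cost e s + T) s'"
  unfolding runs_def using exec.IfFalse add_left_mono by blast

lemma runs_WhileFalse: "expr_val e s = Leaf \<Longrightarrow> runs (While e c) s (expr_cost e s) s"
  unfolding runs_def using exec.WhileFalse by blast

lemma runs_WhileTrue:
  "expr_val e s \<noteq> Leaf \<Longrightarrow> runs c s T1 s' \<Longrightarrow> runs (While e c) s' T2 s'' \<Longrightarrow>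
    runs (While e c) s (expr_cost e s + T1 + T2) s''"
  unfolding runs_def by (meson add_le_mono exec.WhileTrue le_refl)

lemma runs_tree_size: "runs c s T s' \<Longrightarrow> tree_size (s' x) \<le> tree_size (s x) + T"
  unfolding runs_def using exec_tree_size by (meson add_left_mono le_trans)

text \<open>The language has no empty command, so the base case already erases variable 1 and the
  first successor erases it again; this explains the cost \<open>Suc n\<close>. Variable 0, which
  holds the result, is spared.\<close>

fun clear :: "nat \<Rightarrow> com" where
  "clear 0 = Assign 1 NilE"
| "clear (Suc n) = Seq (clear n) (Assign (Suc n) NilE)"

lemma runs_clear:
  assumes "0 < n"
  shows "runs (clear n) s (Suc n) (\<lambda>x. if 0 < x \<and> x \<le> n then Leaf else s x)"
  using assms
proof (induction n)
  case (Suc n)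
  let ?s = "\<lambda>x. if 0 < x \<and> (x \<le> n \<or> x = 1) then Leaf else s x"
  have "runs (clear n) s (Suc n) ?s"
  proof (cases n)
    case 0
    have "?s = s(1 := Leaf)" using 0 by auto
    then show ?thesis using runs_Assign[of NilE s 1 1] 0 by simp
  next
    case (Suc m)
    then have "?s = (\<lambda>x. if 0 < x \<and> x \<le> n then Leaf else s x)" by auto
    then show ?thesis using Suc.IH Suc by simp
  qed
  moreover have "runs (Assign (Suc n) NilE) ?s 1 (?s(Suc n := Leaf))"
    using runs_Assign[of NilE ?s 1 "Suc n"] by simp
  moreover have "?s(Suc n := Leaf) = (\<lambda>x. if 0 < x \<and> x \<le> Suc n then Leaf else s x)"
    by auto
  ultimately show ?case using runs_Seq by fastforce
qed simp


section \<open>Polynomial-time functions on encoded types\<close>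

text \<open>One canonical code per datum. A fraction is a pair of an integer and a natural number
  here, so unequal fractions of equal value are different data.\<close>

class enc =
  fixes enc :: "'a \<Rightarrow> tree"

abbreviation sz :: "'a::enc \<Rightarrow> nat" where
  "sz x \<equiv> tree_size (enc x)"

instantiation tree :: enc
begin
definition "enc = (\<lambda>d::tree. d)"
instance ..
end

instantiation bool :: enc
begin
definition "enc = bit_tree"
instance ..
end

instantiation nat :: enc
begin
definition "enc = nat_tree"
instance ..
end

instantiation int :: enc
begin
definition "enc = int_tree"
instance ..
end

instantiation prod :: (enc, enc) enc
begin
definition "enc = (\<lambda>(a, b). Node (enc a) (enc b))"
instance ..
end

instantiation list :: (enc) enc
begin
primrec enc_list :: "'a list \<Rightarrow> tree" where
  "enc_list [] = Leaf"
| "enc_list (x # xs) = Node (enc x) (enc_list xs)"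
instance ..
end

lemma enc_Pair [simp]: "enc (a, b) = Node (enc a) (enc b)"
  by (simp add: enc_prod_def)

lemma enc_tree [simp]: "enc (d::tree) = d"
  by (simp add: enc_tree_def)

lemma enc_bool [simp]: "enc True = Node Leaf Leaf" "enc False = Leaf"
  by (simp_all add: enc_bool_def bit_tree_def)

lemma enc_fst: "enc (fst z) = tree_hd (enc z)"
  by (cases z) simp

lemma enc_snd: "enc (snd z) = tree_tl (enc z)"
  by (cases z) simp

lemma sz_pos: "0 < sz x"
  by (rule tree_size_pos)

section \<open>Programs as reusable subroutines\<close>

lemma poly_nat_mono: "m \<le> n \<Longrightarrow> poly p m \<le> poly p (n::nat)"
  by (induction p) (auto intro!: add_mono mult_mono)

text \<open>A calling convention: the variables \<open>1..<n\<close> are blank at the start and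
  again at the end, while those from \<open>n\<close> on may hold anything and survive. Hence
  programs can be sequenced and looped with saved data above. The domain \<open>D\<close> admits
  functions whose program is reliable on valid inputs only.\<close>

definition computes :: "com \<Rightarrow> nat \<Rightarrow> 'a::enc set \<Rightarrow> ('a \<Rightarrow> 'b::enc) \<Rightarrow> nat poly \<Rightarrow> bool" where
  "computes P n D f p \<longleftrightarrow> 0 < n \<and> (\<forall>x\<in>D. \<forall>r. r 0 = enc x \<longrightarrow> (\<forall>i. 0 < i \<and> i < n \<longrightarrow> r i = Leaf) \<longrightarrow>
     runs P r (poly p (sz x)) (r(0 := enc (f x))))"

definition ptime :: "'a::enc set \<Rightarrow> ('a \<Rightarrow> 'b::enc) \<Rightarrow> bool" where
  "ptime D f \<longleftrightarrow> (\<exists>P n p. computes P n D f p)"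

text \<open>Raising \<open>n\<close> only strengthens the assumption on the initial store; this is
  how several programs get a common \<open>n\<close>.\<close>

lemma ptimeE:
  assumes "ptime D f"
  obtains P n p where "0 < n" "\<And>m. n \<le> m \<Longrightarrow> computes P m D f p"
proof -
  obtain P n p where P: "computes P n D f p"
    using assms(1) unfolding ptime_def by blast
  then have "computes P m D f p" if "n \<le> m" for m
    using that unfolding computes_def by auto
  then show ?thesis
    using that P unfolding computes_def by blast
qed

lemma computesD:
  "computes P n D f p \<Longrightarrow> x \<in> D \<Longrightarrow> r 0 = enc x \<Longrightarrow> (\<And>i. 0 < i \<Longrightarrow> i < n \<Longrightarrow> r i = Leaf) \<Longrightarrow>
    runs P r (poly p (sz x)) (r(0 := enc (f x)))"
  unfolding computes_def by blast

lemma computes_sz: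
  assumes "computes P n D f p" "x \<in> D"
  shows "sz (f x) \<le> poly p (sz x) + sz x"
proof -
  let ?r = "(\<lambda>_. Leaf)(0 := enc x)"
  have "runs P ?r (poly p (sz x)) (?r(0 := enc (f x)))"
    by (rule computesD[OF assms]) auto
  from runs_tree_size[OF this, of 0] show ?thesis by simp
qed

lemma ptime_halts:
  assumes "ptime D f"
  obtains P p where
    "\<And>x. x \<in> D \<Longrightarrow> \<exists>t. halts_with P (enc x) t (enc (f x)) \<and> t \<le> poly p (sz x)"
proof -
  obtain P n p where P: "computes P n D f p"
    using assms unfolding ptime_def by blast
  show ?thesis
  proof (rule that)
    fix x assume "x \<in> D"
    let ?r = "(\<lambda>_. Leaf)(0 := enc x)"
    have "runs P ?r (poly p (sz x)) (?r(0 := enc (f x)))"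
      using \<open>x \<in> D\<close> by (intro computesD[OF P]) auto
    then obtain t where "t \<le> poly p (sz x)" "exec P ?r t (?r(0 := enc (f x)))"
      unfolding runs_def by blast
    moreover have "(?r(0 := enc (f x))) 0 = enc (f x)" by simp
    ultimately show "\<exists>t. halts_with P (enc x) t (enc (f x)) \<and> t \<le> poly p (sz x)"
      unfolding halts_with_def by blast
  qed
qed

text \<open>A program that halts from the blank store is made reusable by wiping its variables.\<close>

lemma halts_ptime:
  assumes "\<And>x. x \<in> D \<Longrightarrow> \<exists>t. halts_with P (enc x) t (enc (f x)) \<and> t \<le> poly p (sz x)"
  shows "ptime D f"
proof -
  obtain n0 where "com_below n0 P" using ex_com_below ..
  \<comment> \<open>The summand 2 makes \<open>n - 1\<close> positive, as \<open>runs_clear\<close>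
    requires.\<close>
  define n where "n = n0 + 2"
  have n: "com_below n P" using \<open>com_below n0 P\<close> com_below_mono n_def by simp
  have "computes (Seq P (clear (n - 1))) n D f (p + [:n:])"
    unfolding computes_def
  proof (intro conjI ballI allI impI)
    show "0 < n" by (simp add: n_def)
    fix x r assume x: "x \<in> D" and r: "r 0 = enc x" "\<forall>i. 0 < i \<and> i < n \<longrightarrow> r i = Leaf"
    obtain t s where t: "t \<le> poly p (sz x)" and s: "exec P ((\<lambda>_. Leaf)(0 := enc x)) t s" "s 0 = enc (f x)"
      using assms[OF x] unfolding halts_with_def by blast
    have "\<forall>i<n. ((\<lambda>_. Leaf)(0 := enc x)) i = r i" using r by auto
    from exec_frame[OF s(1) n this] obtain r' where
      r': "exec P r t r'" "\<forall>i<n. s i = r' i" "\<forall>i\<ge>n. r' i = r i" by blast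
    have "runs P r (poly p (sz x)) r'" using r'(1) t unfolding runs_def by blast
    moreover have "runs (clear (n - 1)) r' n (\<lambda>i. if 0 < i \<and> i \<le> n - 1 then Leaf else r' i)"
      using runs_clear[of "n - 1" r'] by (simp add: n_def)
    moreover have "(\<lambda>i. if 0 < i \<and> i \<le> n - 1 then Leaf else r' i) = r(0 := enc (f x))"
      using r' r s(2) by (auto simp: n_def fun_eq_iff)
    ultimately show "runs (Seq P (clear (n - 1))) r (poly (p + [:n:]) (sz x)) (r(0 := enc (f x)))"
      using runs_Seq by fastforce
  qed
  then show ?thesis unfolding ptime_def by blast
qed

lemma ptime_mono: "ptime E f \<Longrightarrow> D \<subseteq> E \<Longrightarrow> ptime D f"
  unfolding ptime_def computes_def by blast

text \<open>Programs see only codes, so functions into different types share a program if their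
  values have equal codes: a list cell is a pair, a parity is the head of a numeral, halving is its
  tail.\<close>

lemma ptime_recode:
  assumes "ptime D f" "\<And>x. x \<in> D \<Longrightarrow> enc (g x) = enc (f x)"
  shows "ptime D g"
proof -
  obtain P n p where P: "computes P n D f p"
    using assms(1) unfolding ptime_def by blast
  then have "computes P n D g p"
    using assms(2) unfolding computes_def by simp
  then show ?thesis
    unfolding ptime_def by blast
qed

lemma ptime_cong: "ptime D f \<Longrightarrow> (\<And>x. x \<in> D \<Longrightarrow> g x = f x) \<Longrightarrow> ptime D g"
  by (rule ptime_recode[of D f g]) simp_all

section \<open>Closure of polynomial time under composition, pairing, branching and
  iteration\<close>

lemma ptime_expr:
  assumes e: "expr_below 1 e" and cost: "\<And>d. expr_cost e (\<lambda>_. d) \<le> poly p (tree_size d)"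
    and val: "\<And>x. x \<in> D \<Longrightarrow> enc (f x) = expr_val e (\<lambda>_. enc x)"
  shows "ptime D f"
proof -
  have "computes (Assign 0 e) 1 D f p"
    unfolding computes_def
  proof (intro conjI ballI allI impI)
    fix x and r :: store assume x: "x \<in> D" and r: "r 0 = enc x"
    have eq: "expr_val e r = expr_val e (\<lambda>_. enc x)" "expr_cost e r = expr_cost e (\<lambda>_. enc x)"
      using expr_below_cong[OF e, of r "\<lambda>_. enc x"] r by simp_all
    show "runs (Assign 0 e) r (poly p (sz x)) (r(0 := enc (f x)))"
      using runs_Assign[of e r "poly p (sz x)" 0] cost eq val[OF x] by simp
  qed simp
  then show ?thesis unfolding ptime_def by blast
qed

lemma ptime_id: "ptime D (\<lambda>x. x)"
  by (rule ptime_expr[of "Var 0" "[:0, 1:]"]) simp_all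

fun tree_expr :: "tree \<Rightarrow> expr" where
  "tree_expr Leaf = NilE"
| "tree_expr (Node a b) = ConsE (tree_expr a) (tree_expr b)"

lemma ptime_const: "ptime D (\<lambda>x. k)"
proof (rule ptime_expr)
  show "expr_below 1 (tree_expr d)" for d by (induction d) auto
  have val: "expr_val (tree_expr d) s = d" for d s by (induction d) auto
  then show "enc k = expr_val (tree_expr (enc k)) s" for s by simp
  have "expr_cost (tree_expr d) s = expr_cost (tree_expr d) s'" for d s s'
    by (induction d) (simp_all add: val)
  then show "expr_cost (tree_expr (enc k)) (\<lambda>_. d) \<le>
      poly [:expr_cost (tree_expr (enc k)) (\<lambda>_. Leaf):] (tree_size d)" for d
    by (simp add: eq_imp_le)
qed

lemma ptime_comp:
  assumes "ptime D f" "ptime E g" "\<And>x. x \<in> D \<Longrightarrow> f x \<in> E"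
  shows "ptime D (\<lambda>x. g (f x))"
proof -
  obtain P n p where n: "0 < n" and P: "\<And>m. n \<le> m \<Longrightarrow> computes P m D f p"
    using assms(1) by (rule ptimeE) auto
  obtain Q m q where m: "0 < m" and Q: "\<And>i. m \<le> i \<Longrightarrow> computes Q i E g q"
    using assms(2) by (rule ptimeE) auto
  define N where "N = n + m"
  have PN: "computes P N D f p" and QN: "computes Q N E g q"
    using P Q N_def by auto
  \<comment> \<open>The intermediate result has at most the size of the input plus the time spent on
    it; this is the argument \<open>p + [:0, 1:]\<close> of \<open>q\<close>.\<close>
  have "computes (Seq P Q) N D (\<lambda>x. g (f x)) (p + pcompose q (p + [:0, 1:]))"
    unfolding computes_def
  proof (intro conjI ballI allI impI)
    show "0 < N" using n by (simp add: N_def)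
    fix x r assume x: "x \<in> D" and r: "r 0 = enc x" "\<forall>i. 0 < i \<and> i < N \<longrightarrow> r i = Leaf"
    have "runs P r (poly p (sz x)) (r(0 := enc (f x)))"
      using r by (intro computesD[OF PN x]) auto
    moreover have "runs Q (r(0 := enc (f x))) (poly q (sz (f x))) ((r(0 := enc (f x)))(0 := enc (g (f x))))"
      using r by (intro computesD[OF QN assms(3)[OF x]]) auto
    ultimately have "runs (Seq P Q) r (poly p (sz x) + poly q (sz (f x))) (r(0 := enc (g (f x))))"
      using runs_Seq by fastforce
    then show "runs (Seq P Q) r (poly (p + pcompose q (p + [:0, 1:])) (sz x)) (r(0 := enc (g (f x))))"
      by (rule runs_mono) (use computes_sz[OF PN x] in \<open>auto simp: poly_pcompose intro!: poly_nat_mono\<close>)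
  qed
  then show ?thesis unfolding ptime_def by blast
qed

lemma ptime_fst: "ptime D f \<Longrightarrow> ptime D (\<lambda>x. fst (f x))"
  by (erule ptime_comp[where E = UNIV], rule ptime_expr[of "HdE (Var 0)" "[:0, 2:]"])
     (auto simp: enc_fst, case_tac d, auto)

lemma ptime_snd: "ptime D f \<Longrightarrow> ptime D (\<lambda>x. snd (f x))"
  by (erule ptime_comp[where E = UNIV], rule ptime_expr[of "TlE (Var 0)" "[:0, 2:]"])
     (auto simp: enc_snd, case_tac d, auto)

lemma ptime_Pair:
  assumes "ptime D f" "ptime D g"
  shows "ptime D (\<lambda>x. (f x, g x))"
proof -
  obtain P n p where n: "0 < n" and P: "\<And>m. n \<le> m \<Longrightarrow> computes P m D f p"
    using assms(1) by (rule ptimeE) auto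
  obtain Q m q where m: "0 < m" and Q: "\<And>i. m \<le> i \<Longrightarrow> computes Q i D g q"
    using assms(2) by (rule ptimeE) auto
  define N where "N = n + m"
  have PN: "computes P N D f p" and QN: "computes Q N D g q" and N: "0 < N"
    using P Q n by (auto simp: N_def)
  \<comment> \<open>Variable \<open>N\<close> keeps the input while \<open>P\<close> overwrites
    variable 0, and \<open>Suc N\<close> keeps the first result while \<open>Q\<close> runs.\<close>
  define C where "C =
    Seq (Assign N (Var 0)) (Seq P (Seq (Assign (Suc N) (Var 0)) (Seq (Assign 0 (Var N))
      (Seq Q (Seq (Assign 0 (ConsE (Var (Suc N)) (Var 0))) (Seq (Assign N NilE) (Assign (Suc N) NilE)))))))"
  have "computes C (Suc (Suc N)) D (\<lambda>x. (f x, g x)) (smult 4 p + smult 3 q + [:3, 7:])"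
    unfolding computes_def
  proof (intro conjI ballI allI impI)
    fix x r assume x: "x \<in> D" and r: "r 0 = enc x" "\<forall>i. 0 < i \<and> i < Suc (Suc N) \<longrightarrow> r i = Leaf"
    let ?F = "enc (f x)" and ?G = "enc (g x)"
    define r1 where "r1 = r(N := enc x)"
    define r2 where "r2 = r1(0 := ?F)"
    define r3 where "r3 = r2(Suc N := ?F)"
    define r4 where "r4 = r3(0 := enc x)"
    define r5 where "r5 = r4(0 := ?G)"
    define r6 where "r6 = r5(0 := Node ?F ?G)"
    define r7 where "r7 = r6(N := Leaf)"
    note defs = r1_def r2_def r3_def r4_def r5_def r6_def r7_def
    have "runs (Assign N (Var 0)) r (sz x) r1"
      using runs_Assign[of "Var 0" r _ N] r by (simp add: defs)
    moreover have "runs P r1 (poly p (sz x)) r2"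
      unfolding r2_def using r N by (intro computesD[OF PN x]) (auto simp: defs)
    moreover have "runs (Assign (Suc N) (Var 0)) r2 (sz (f x)) r3"
      using runs_Assign[of "Var 0" r2 _ "Suc N"] by (simp add: defs)
    moreover have "runs (Assign 0 (Var N)) r3 (sz x) r4"
      using runs_Assign[of "Var N" r3 "sz x" 0] N by (simp add: defs)
    moreover have "runs Q r4 (poly q (sz x)) r5"
      unfolding r5_def using r N by (intro computesD[OF QN x]) (auto simp: defs)
    moreover have "runs (Assign 0 (ConsE (Var (Suc N)) (Var 0))) r5 (2 * sz (f x) + 2 * sz (g x) + 1) r6"
      using runs_Assign[of "ConsE (Var (Suc N)) (Var 0)" r5 _ 0] N by (simp add: defs)
    moreover have "runs (Assign N NilE) r6 1 r7"
      using runs_Assign[of NilE r6 1 N] by (simp add: r7_def)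
    moreover have "runs (Assign (Suc N) NilE) r7 1 (r7(Suc N := Leaf))"
      using runs_Assign[of NilE r7 1 "Suc N"] by simp
    ultimately have "runs C r (sz x + (poly p (sz x) + (sz (f x) + (sz x + (poly q (sz x) +
        ((2 * sz (f x) + 2 * sz (g x) + 1) + (1 + 1))))))) (r7(Suc N := Leaf))"
      unfolding C_def by (intro runs_Seq)
    moreover have "r7(Suc N := Leaf) = r(0 := enc (f x, g x))"
      using r N by (auto simp: defs fun_eq_iff)
    ultimately show "runs C r (poly (smult 4 p + smult 3 q + [:3, 7:]) (sz x)) (r(0 := enc (f x, g x)))"
      using computes_sz[OF PN x] computes_sz[OF QN x]
      by (auto elim!: runs_mono)
  qed simp
  then show ?thesis unfolding ptime_def by blast
qed

text \<open>The language branches on being \<open>Leaf\<close>, so the tested value may have any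
  type; this yields the zero test for numbers. Each branch has to be computable only on the inputs
  that reach it.\<close>

lemma ptime_test:
  assumes "ptime D b" "ptime {x\<in>D. c x} f" "ptime {x\<in>D. \<not> c x} g"
    and c: "\<And>x. x \<in> D \<Longrightarrow> c x \<longleftrightarrow> enc (b x) \<noteq> Leaf"
  shows "ptime D (\<lambda>x. if c x then f x else g x)"
proof -
  obtain B l b' where l: "0 < l" and B: "\<And>m. l \<le> m \<Longrightarrow> computes B m D b b'"
    using assms(1) by (rule ptimeE) auto
  obtain P n p where n: "0 < n" and P: "\<And>m. n \<le> m \<Longrightarrow> computes P m {x\<in>D. c x} f p"
    using assms(2) by (rule ptimeE) auto
  obtain Q m q where m: "0 < m" and Q: "\<And>i. m \<le> i \<Longrightarrow> computes Q i {x\<in>D. \<not> c x} g q"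
    using assms(3) by (rule ptimeE) auto
  define N where "N = l + n + m"
  have BN: "computes B N D b b'" and PN: "computes P N {x\<in>D. c x} f p"
    and QN: "computes Q N {x\<in>D. \<not> c x} g q" and N: "0 < N"
    using P Q B n by (auto simp: N_def)
  define C where "C =
    Seq (Assign N (Var 0)) (Seq B (Seq (Assign (Suc N) (Var 0)) (Seq (Assign 0 (Var N))
      (Seq (Assign N NilE) (If (Var (Suc N)) (Seq (Assign (Suc N) NilE) P) Q)))))"
  let ?p = "smult 3 b' + p + q + [:2, 4:]"
  have "computes C (Suc (Suc N)) D (\<lambda>x. if c x then f x else g x) ?p"
    unfolding computes_def
  proof (intro conjI ballI allI impI)
    fix x r assume x: "x \<in> D" and r: "r 0 = enc x" "\<forall>i. 0 < i \<and> i < Suc (Suc N) \<longrightarrow> r i = Leaf"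
    define r1 where "r1 = r(N := enc x)"
    define r2 where "r2 = r1(0 := enc (b x))"
    define r3 where "r3 = r2(Suc N := enc (b x))"
    define r4 where "r4 = r3(0 := enc x)"
    define r5 where "r5 = r4(N := Leaf)"
    define h where "h = (if c x then f x else g x)"
    note defs = r1_def r2_def r3_def r4_def r5_def
    have r5: "r5 = r(Suc N := enc (b x))" using r N by (auto simp: defs fun_eq_iff)
    have "runs (If (Var (Suc N)) (Seq (Assign (Suc N) NilE) P) Q) r5
       (sz (b x) + (1 + poly p (sz x) + poly q (sz x))) (r(0 := enc h))"
    proof (cases "c x")
      case True
      have "runs P r (poly p (sz x)) (r(0 := enc (f x)))"
        using r x True by (intro computesD[OF PN]) auto
      moreover have "runs (Assign (Suc N) NilE) r5 1 r"
      proof -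
        have "r5(Suc N := Leaf) = r" using r by (auto simp: r5 fun_eq_iff)
        then show ?thesis using runs_Assign[of NilE r5 1 "Suc N"] by simp
      qed
      ultimately have "runs (Seq (Assign (Suc N) NilE) P) r5 (1 + poly p (sz x)) (r(0 := enc h))"
        unfolding h_def using True by (simp only: if_True) (rule runs_Seq)
      from runs_IfTrue[OF _ this, of "Var (Suc N)" Q] show ?thesis
        using c[OF x] True by (auto simp: r5 elim: runs_mono)
    next
      case False
      then have b: "enc (b x) = Leaf" using c[OF x] by simp
      then have "r5 = r" using r by (auto simp: r5 fun_eq_iff)
      moreover have "runs Q r (poly q (sz x)) (r(0 := enc (g x)))"
        using r x False by (intro computesD[OF QN]) auto
      ultimately have "runs Q r5 (poly q (sz x)) (r(0 := enc h))"
        using False by (simp add: h_def)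
      from runs_IfFalse[OF _ this, of "Var (Suc N)" "Seq (Assign (Suc N) NilE) P"] show ?thesis
        using b by (auto simp: r5 elim: runs_mono)
    qed
    moreover have "runs (Assign N (Var 0)) r (sz x) r1"
      using runs_Assign[of "Var 0" r _ N] r by (simp add: defs)
    moreover have "runs B r1 (poly b' (sz x)) r2"
      unfolding r2_def using r N by (intro computesD[OF BN x]) (auto simp: defs)
    moreover have "runs (Assign (Suc N) (Var 0)) r2 (sz (b x)) r3"
      using runs_Assign[of "Var 0" r2 _ "Suc N"] by (simp add: defs)
    moreover have "runs (Assign 0 (Var N)) r3 (sz x) r4"
      using runs_Assign[of "Var N" r3 "sz x" 0] N by (simp add: defs)
    moreover have "runs (Assign N NilE) r4 1 r5"
      using runs_Assign[of NilE r4 1 N] by (simp add: r5_def)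
    ultimately have "runs C r (sz x + (poly b' (sz x) + (sz (b x) + (sz x + (1 +
        (sz (b x) + (1 + poly p (sz x) + poly q (sz x)))))))) (r(0 := enc h))"
      unfolding C_def by (intro runs_Seq)
    then show "runs C r (poly ?p (sz x)) (r(0 := enc (if c x then f x else g x)))"
      unfolding h_def using computes_sz[OF BN x]
      by (elim runs_mono) simp
  qed simp
  then show ?thesis unfolding ptime_def by blast
qed

lemma sz_append: "sz (xs @ ys) + 1 = sz xs + sz (ys :: 'a::enc list)"
  by (induction xs) auto

lemma length_less_sz: "length xs < sz (xs :: 'a::enc list)"
  by (induction xs) auto

text \<open>A polynomial step alone is not enough: one that doubles the accumulator would reach
  exponential size. Hence the bound on the accumulator after every prefix of the list. The context
  \<open>x\<close> is handed unchanged to each step, and \<open>E\<close> only has to contain the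
  triples that actually occur.\<close>

lemma ptime_fold_core:
  fixes step :: "'a::enc \<Rightarrow> 'b::enc \<Rightarrow> 'c::enc \<Rightarrow> 'c"
  assumes step: "ptime E (\<lambda>z. step (fst z) (fst (snd z)) (snd (snd z)))"
    and E: "\<And>x ys a zs acc. (x, ys @ a # zs, acc) \<in> D \<Longrightarrow> (x, a, fold (step x) ys acc) \<in> E"
    and bound: "\<And>x ys zs acc. (x, ys @ zs, acc) \<in> D \<Longrightarrow>
      sz (fold (step x) ys acc) \<le> poly q (sz (x, ys @ zs, acc))"
  shows "ptime D (\<lambda>w. fold (step (fst w)) (fst (snd w)) (snd (snd w)))"
proof -
  let ?h = "\<lambda>z. step (fst z) (fst (snd z)) (snd (snd z))"
  obtain P N p where N: "0 < N" and P: "\<And>m. N \<le> m \<Longrightarrow> computes P m E ?h p"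
    using step by (rule ptimeE) auto
  have PN: "computes P N E ?h p" using P by simp
  define body where "body =
    Seq (Assign 0 (ConsE (Var N) (ConsE (HdE (Var (N+1))) (Var (N+2)))))
     (Seq P (Seq (Assign (N+2) (Var 0)) (Assign (N+1) (TlE (Var (N+1))))))"
  define loop where "loop = While (Var (N+1)) body"
  define C where "C =
    Seq (Assign N (HdE (Var 0))) (Seq (Assign (N+1) (HdE (TlE (Var 0)))) (Seq (Assign (N+2) (TlE (TlE (Var 0))))
     (Seq loop (Seq (Assign 0 (Var (N+2))) (Seq (Assign N NilE) (Seq (Assign (N+1) NilE) (Assign (N+2) NilE)))))))"
  \<comment> \<open>\<open>B\<close> bounds the input of one step, \<open>T\<close> the cost of one
    round with its loop test, \<open>R\<close> the whole run.\<close>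
  define B where "B = [:2, 1:] + q"
  define T where "T = smult 12 B + pcompose p B"
  define R where "R = [:1, 1:] * T + B + [:3, 8:]"
  have "computes C (N+3) D (\<lambda>w. fold (step (fst w)) (fst (snd w)) (snd (snd w))) R"
    unfolding computes_def
  proof (intro conjI ballI allI impI)
    fix w r assume "w \<in> D" and r0: "r 0 = enc w" and r: "\<forall>i. 0 < i \<and> i < N+3 \<longrightarrow> r i = Leaf"
    obtain x us acc where w: "w = (x, us, acc)" by (cases w) auto
    have D: "(x, us, acc) \<in> D" using \<open>w \<in> D\<close> w by simp
    define S where "S = sz w"
    define b where "b = poly B S"
    have b: "b = 2 + S + poly q S" by (simp add: b_def B_def)
    have TS: "poly T S = 12 * b + poly p b" by (simp add: T_def b_def poly_pcompose)
    let ?A = "\<lambda>ys. fold (step x) ys acc"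
    have accb: "sz (?A ys) \<le> poly q S" if "us = ys @ zs" for ys zs
      using bound[of x ys zs acc] D that by (simp add: S_def w)
    \<comment> \<open>Loop invariant with \<open>ys\<close> done and \<open>zs\<close> left;
      \<open>v\<close> is whatever the last step left in variable 0. The \<open>Suc\<close> pays for
      the final failing test.\<close>
    have loop: "\<exists>v. runs loop s (Suc (length zs) * poly T S)
        (s(0 := v, N+1 := Leaf, N+2 := enc (?A us)))"
      if "us = ys @ zs" "s N = enc x" "s (N+1) = enc zs" "s (N+2) = enc (?A ys)"
        "\<forall>i. 0 < i \<and> i < N \<longrightarrow> s i = Leaf" for ys zs s
      using that
    proof (induction zs arbitrary: ys s)
      case Nil
      then have "s(0 := s 0, N+1 := Leaf, N+2 := enc (?A us)) = s"
        by (auto simp: fun_eq_iff)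
      moreover have "runs loop s (expr_cost (Var (N+1)) s) s"
        unfolding loop_def using Nil by (intro runs_WhileFalse) simp
      ultimately have "runs loop s (Suc (length []) * poly T S) (s(0 := s 0, N+1 := Leaf, N+2 := enc (?A us)))"
        using Nil by (auto simp: TS b elim!: runs_mono)
      then show ?case ..
    next
      case (Cons a zs)
      let ?z = "(x, a, ?A ys)"
      have zE: "?z \<in> E" using E[of x ys a zs acc] D Cons.prems(1) by simp
      have S1: "sz x + sz us + sz acc + 2 = S" by (simp add: S_def w)
      have S2: "sz us + 1 = sz ys + sz (a # zs)"
        using sz_append[of ys "a # zs"] Cons.prems(1) by simp
      have S3: "sz x + sz (a # zs) \<le> S" using S1 S2 sz_pos[of ys] by linarith
      have S3': "sz x + sz a + sz zs + 1 \<le> S" using S3 by simp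
      have S4: "sz (?A ys) \<le> poly q S" using accb Cons.prems(1) by blast
      have S5: "sz (?A (ys @ [a])) \<le> poly q S" using accb[of "ys @ [a]" zs] Cons.prems(1) by simp
      have z: "sz ?z \<le> b" using S3' S4 sz_pos[of zs] by (simp add: b)
      define s1 where "s1 = s(0 := enc ?z)"
      define s2 where "s2 = s1(0 := enc (?A (ys @ [a])))"
      define s3 where "s3 = s2(N+2 := enc (?A (ys @ [a])))"
      define s4 where "s4 = s3(N+1 := enc zs)"
      note defs = s1_def s2_def s3_def s4_def
      have "runs (Assign 0 (ConsE (Var N) (ConsE (HdE (Var (N+1))) (Var (N+2))))) s (7 * b) s1"
        using runs_Assign[of "ConsE (Var N) (ConsE (HdE (Var (N+1))) (Var (N+2)))" s "7 * b" 0]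
          Cons.prems z S3' S4 by (simp add: s1_def b)
      moreover have "runs P s1 (poly p b) s2"
      proof -
        have "runs P s1 (poly p (sz ?z)) (s1(0 := enc (?h ?z)))"
          using Cons.prems(5) by (intro computesD[OF PN zE]) (auto simp: s1_def)
        then show ?thesis
          using poly_nat_mono[OF z, of p] by (auto simp: s2_def elim!: runs_mono)
      qed
      moreover have "runs (Assign (N+2) (Var 0)) s2 b s3"
        using runs_Assign[of "Var 0" s2 b "N+2"] S5 by (simp add: s2_def s3_def b)
      moreover have "runs (Assign (N+1) (TlE (Var (N+1)))) s3 (2 * b) s4"
      proof -
        have "s3 (N+1) = enc (a # zs)" using Cons.prems(3) by (simp add: defs)
        then show ?thesis
          using runs_Assign[of "TlE (Var (N+1))" s3 "2 * b" "N+1"] S3' by (simp add: s4_def b)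
      qed
      ultimately have "runs body s (7 * b + (poly p b + (b + 2 * b))) s4"
        unfolding body_def by (intro runs_Seq)
      moreover have "\<exists>v. runs loop s4 (Suc (length zs) * poly T S) (s4(0 := v, N+1 := Leaf, N+2 := enc (?A us)))"
      proof (rule Cons.IH)
        show "us = (ys @ [a]) @ zs" using Cons.prems(1) by simp
      qed (use Cons.prems N in \<open>auto simp: defs\<close>)
      then obtain v where "runs loop s4 (Suc (length zs) * poly T S) (s4(0 := v, N+1 := Leaf, N+2 := enc (?A us)))" ..
      ultimately have "runs loop s (expr_cost (Var (N+1)) s + (7 * b + (poly p b + (b + 2 * b))) + Suc (length zs) * poly T S)
          (s4(0 := v, N+1 := Leaf, N+2 := enc (?A us)))"
        unfolding loop_def using Cons.prems(3) by (intro runs_WhileTrue) auto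
      moreover have "s4(0 := v, N+1 := Leaf, N+2 := enc (?A us)) = s(0 := v, N+1 := Leaf, N+2 := enc (?A us))"
        using N by (auto simp: defs fun_eq_iff)
      moreover have "expr_cost (Var (N+1)) s \<le> b" using Cons.prems(3) S3' by (simp add: b)
      ultimately have "runs loop s (Suc (length (a # zs)) * poly T S) (s(0 := v, N+1 := Leaf, N+2 := enc (?A us)))"
        by (auto simp: TS elim!: runs_mono)
      then show ?case ..
    qed
    define r1 where "r1 = r(N := enc x)"
    define r2 where "r2 = r1(N+1 := enc us)"
    define r3 where "r3 = r2(N+2 := enc acc)"
    have "\<exists>v. runs loop r3 (Suc (length us) * poly T S) (r3(0 := v, N+1 := Leaf, N+2 := enc (?A us)))"
      by (rule loop[of "[]"]) (use r N in \<open>auto simp: r1_def r2_def r3_def\<close>)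
    then obtain v where v: "runs loop r3 (Suc (length us) * poly T S) (r3(0 := v, N+1 := Leaf, N+2 := enc (?A us)))" ..
    define r4 where "r4 = r3(0 := v, N+1 := Leaf, N+2 := enc (?A us))"
    define r5 where "r5 = r4(0 := enc (?A us))"
    define r6 where "r6 = r5(N := Leaf)"
    define r7 where "r7 = r6(N+1 := Leaf)"
    note defs = r1_def r2_def r3_def r4_def r5_def r6_def r7_def
    have S: "S = 2 + sz x + sz us + sz acc" by (simp add: S_def w)
    have "runs (Assign N (HdE (Var 0))) r (2 * S) r1"
      using runs_Assign[of "HdE (Var 0)" r "2 * S" N] r0 by (simp add: r1_def w S)
    moreover have "runs (Assign (N+1) (HdE (TlE (Var 0)))) r1 (3 * S) r2"
      using runs_Assign[of "HdE (TlE (Var 0))" r1 "3 * S" "N+1"] r0 N by (simp add: r1_def r2_def w S)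
    moreover have "runs (Assign (N+2) (TlE (TlE (Var 0)))) r2 (3 * S) r3"
      using runs_Assign[of "TlE (TlE (Var 0))" r2 "3 * S" "N+2"] r0 N by (simp add: r1_def r2_def r3_def w S)
    moreover have "runs loop r3 ((S + 1) * poly T S) r4"
      using v length_less_sz[of us] unfolding r4_def
      by (elim runs_mono) (intro mult_right_mono, auto simp: S)
    moreover have "runs (Assign 0 (Var (N+2))) r4 b r5"
      using runs_Assign[of "Var (N+2)" r4 b 0] accb[of us "[]"] by (simp add: r4_def r5_def b)
    moreover have "runs (Assign N NilE) r5 1 r6"
      using runs_Assign[of NilE r5 1 N] by (simp add: r6_def)
    moreover have "runs (Assign (N+1) NilE) r6 1 r7"
      using runs_Assign[of NilE r6 1 "N+1"] by (simp add: r7_def)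
    moreover have "runs (Assign (N+2) NilE) r7 1 (r7(N+2 := Leaf))"
      using runs_Assign[of NilE r7 1 "N+2"] by simp
    ultimately have "runs C r (2 * S + (3 * S + (3 * S + ((S + 1) * poly T S + (b + (1 + (1 + 1))))))) (r7(N+2 := Leaf))"
      unfolding C_def by (intro runs_Seq)
    moreover have "r7(N+2 := Leaf) = r(0 := enc (?A us))"
      using r N by (auto simp: defs fun_eq_iff)
    moreover have "2 * S + (3 * S + (3 * S + ((S + 1) * poly T S + (b + (1 + (1 + 1)))))) = poly R S"
      by (simp add: R_def b_def algebra_simps)
    ultimately show "runs C r (poly R (sz w)) (r(0 := enc (fold (step (fst w)) (fst (snd w)) (snd (snd w)))))"
      by (simp add: S_def w)
  qed simp
  then show ?thesis unfolding ptime_def by blast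
qed


named_theorems ptime_intros

declare ptime_id [ptime_intros] ptime_const [ptime_intros] ptime_Pair [ptime_intros]
  ptime_fst [ptime_intros] ptime_snd [ptime_intros]

lemma ptime_sz:
  assumes "ptime D f"
  obtains q where "\<And>x. x \<in> D \<Longrightarrow> sz (f x) \<le> poly q (sz x)"
proof -
  obtain P n p where P: "computes P n D f p"
    using assms unfolding ptime_def by blast
  have "sz (f x) \<le> poly (p + [:0, 1:]) (sz x)" if "x \<in> D" for x
    using computes_sz[OF P that] by simp
  then show ?thesis by (rule that)
qed

lemma ptime_tree_hd: "ptime D f \<Longrightarrow> ptime D (\<lambda>x. tree_hd (enc (f x)))"
  by (erule ptime_comp[where E = UNIV], rule ptime_expr[of "HdE (Var 0)" "[:0, 2:]"])
     (auto, case_tac d, auto)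

lemma ptime_tree_tl: "ptime D f \<Longrightarrow> ptime D (\<lambda>x. tree_tl (enc (f x)))"
  by (erule ptime_comp[where E = UNIV], rule ptime_expr[of "TlE (Var 0)" "[:0, 2:]"])
     (auto, case_tac d, auto)

lemma ptime_Node: "ptime D f \<Longrightarrow> ptime D g \<Longrightarrow> ptime D (\<lambda>x. Node (enc (f x)) (enc (g x)))"
  by (rule ptime_recode[OF ptime_Pair]) auto

lemma ptime_Cons [ptime_intros]: "ptime D f \<Longrightarrow> ptime D g \<Longrightarrow> ptime D (\<lambda>x. f x # g x)"
  by (rule ptime_recode[OF ptime_Pair]) auto

lemma ptime_if [ptime_intros]:
  assumes "ptime D c" "ptime D f" "ptime D g"
  shows "ptime D (\<lambda>x. if c x then f x else g x)"
proof (rule ptime_test[OF assms(1)])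
  show "c x \<longleftrightarrow> enc (c x) \<noteq> Leaf" for x by (cases "c x") auto
qed (auto intro: ptime_mono[OF assms(2)] ptime_mono[OF assms(3)])

lemma ptime_not [ptime_intros]: "ptime D c \<Longrightarrow> ptime D (\<lambda>x. \<not> c x)"
  by (rule ptime_cong[OF ptime_if[of D c "\<lambda>_. False" "\<lambda>_. True"]]) (auto intro: ptime_const)

lemma ptime_conj [ptime_intros]: "ptime D c \<Longrightarrow> ptime D d \<Longrightarrow> ptime D (\<lambda>x. c x \<and> d x)"
  by (rule ptime_cong[OF ptime_if[of D c d "\<lambda>_. False"]]) (auto intro: ptime_const)

lemma ptime_disj [ptime_intros]: "ptime D c \<Longrightarrow> ptime D d \<Longrightarrow> ptime D (\<lambda>x. c x \<or> d x)"
  by (rule ptime_cong[OF ptime_if[of D c "\<lambda>_. True" d]]) (auto intro: ptime_const)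

lemma ptime_bool_eq [ptime_intros]:
  "ptime D c \<Longrightarrow> ptime D d \<Longrightarrow> ptime D (\<lambda>x. c x \<longleftrightarrow> d x)"
  by (rule ptime_cong[OF ptime_if[of D c d "\<lambda>x. \<not> d x"]]) (auto intro: ptime_not)


subsection \<open>Iteration over lists\<close>

lemma ptime_fold:
  assumes l: "ptime D l" and ini: "ptime D ini"
    and step: "ptime E (\<lambda>z. step (fst z) (fst (snd z)) (snd (snd z)))"
    and E: "\<And>x ys a zs. x \<in> D \<Longrightarrow> l x = ys @ a # zs \<Longrightarrow> (x, a, fold (step x) ys (ini x)) \<in> E"
    and bound: "\<And>x ys zs. x \<in> D \<Longrightarrow> l x = ys @ zs \<Longrightarrow>
      sz (fold (step x) ys (ini x)) \<le> poly q (sz (x, l x, ini x))"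
  shows "ptime D (\<lambda>x. fold (step x) (l x) (ini x))"
proof -
  let ?D = "(\<lambda>x. (x, l x, ini x)) ` D"
  have "ptime ?D (\<lambda>w. fold (step (fst w)) (fst (snd w)) (snd (snd w)))"
  proof (rule ptime_fold_core[OF step])
    show "(x, a, fold (step x) ys acc) \<in> E" if "(x, ys @ a # zs, acc) \<in> ?D" for x ys a zs acc
      using that by (auto dest: sym intro: E)
    show "sz (fold (step x) ys acc) \<le> poly q (sz (x, ys @ zs, acc))"
      if "(x, ys @ zs, acc) \<in> ?D" for x ys zs acc
    proof -
      have "x \<in> D" "l x = ys @ zs" "ini x = acc" using that by auto
      then show ?thesis using bound[of x ys zs] by simp
    qed
  qed
  from ptime_comp[OF ptime_Pair[OF ptime_id ptime_Pair[OF l ini]] this]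
  show ?thesis by simp
qed

lemma sz_member: "a \<in> set xs \<Longrightarrow> sz a < sz (xs :: 'a::enc list)"
  by (induction xs) auto

text \<open>When the growth in a step depends on the context and the entry but not on the
  accumulator, the total growth is at most the list length times one fixed amount, which is the size
  condition of \<open>ptime_fold\<close>.\<close>

lemma ptime_fold_additive:
  assumes l: "ptime D l" and ini: "ptime D ini"
    and step: "ptime UNIV (\<lambda>z. step (fst z) (fst (snd z)) (snd (snd z)))"
    and add: "\<And>x a acc. sz (step x a acc) \<le> sz acc + poly q (sz x + sz a)"
  shows "ptime D (\<lambda>x. fold (step x) (l x) (ini x))"
proof (rule ptime_fold[OF l ini step])
  fix x ys zs assume x: "x \<in> D" "l x = ys @ zs"
  let ?S = "sz (x, l x, ini x)"
  have "sz (fold (step x) ys (ini x)) \<le> sz (ini x) + length ys * poly q ?S" if "set ys \<subseteq> set (l x)" for ys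
    using that
  proof (induction ys rule: rev_induct)
    case (snoc a ys)
    have "sz x + sz a \<le> ?S" using sz_member[of a "l x"] snoc.prems by simp
    then have "poly q (sz x + sz a) \<le> poly q ?S" by (rule poly_nat_mono)
    then show ?case
      using snoc add[of x a "fold (step x) ys (ini x)"] by simp
  qed simp
  then have "sz (fold (step x) ys (ini x)) \<le> sz (ini x) + length ys * poly q ?S"
    using x by simp
  also have "length ys \<le> ?S"
    using length_less_sz[of "l x"] x by simp
  finally have "sz (fold (step x) ys (ini x)) \<le> ?S + ?S * poly q ?S" by simp
  then show "sz (fold (step x) ys (ini x)) \<le> poly ([:0, 1:] + [:0, 1:] * q) ?S"
    by simp
qed simp

lemma ptime_rev [ptime_intros]:
  assumes "ptime D l" shows "ptime D (\<lambda>x. rev (l x))"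
proof -
  have "ptime D (\<lambda>x. fold (\<lambda>a acc. a # acc) (l x) [])"
    by (rule ptime_fold_additive[of D l "\<lambda>_. []" "\<lambda>_ a acc. a # acc" "[:1, 1:]"])
       (intro ptime_intros assms | simp)+
  then show ?thesis by (simp add: fold_Cons_rev)
qed

lemma ptime_append [ptime_intros]:
  assumes "ptime D l" "ptime D m" shows "ptime D (\<lambda>x. l x @ m x)"
proof -
  have "ptime D (\<lambda>x. fold (\<lambda>a acc. a # acc) (rev (l x)) (m x))"
    by (rule ptime_fold_additive[of D _ m "\<lambda>_ a acc. a # acc" "[:1, 1:]"])
       (intro ptime_intros assms | simp)+
  then show ?thesis by (simp add: fold_Cons_rev)
qed

lemma ptime_concat [ptime_intros]:
  assumes "ptime D l" shows "ptime D (\<lambda>x. concat (l x))"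
proof -
  have "ptime D (\<lambda>x. fold (\<lambda>a acc. acc @ a) (l x) [])"
  proof (rule ptime_fold_additive[of D l "\<lambda>_. []" "\<lambda>_ a acc. acc @ a" "[:0, 1:]"])
    show "sz (acc @ a) \<le> sz acc + poly [:0, 1:] (sz x + sz a)" for acc a :: "'b list" and x :: 'a
      using sz_append[of acc a] by simp
  qed (intro ptime_intros assms)+
  moreover have "fold (\<lambda>a acc. acc @ a) ls bs = bs @ concat ls" for ls and bs :: "'b list"
    by (induction ls arbitrary: bs) auto
  ultimately show ?thesis by simp
qed

text \<open>The domain \<open>E\<close> serves functions such as the energy, which are computable
  only on arguments arising from valid data.\<close>

lemma ptime_map:
  assumes l: "ptime D l" and f: "ptime E (\<lambda>z. f (fst z) (snd z))"
    and E: "\<And>x a. x \<in> D \<Longrightarrow> a \<in> set (l x) \<Longrightarrow> (x, a) \<in> E"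
  shows "ptime D (\<lambda>x. map (f x) (l x))"
proof -
  obtain q where q: "\<And>z. z \<in> E \<Longrightarrow> sz (f (fst z) (snd z)) \<le> poly q (sz z)"
    using f by (rule ptime_sz) auto
  define F where "F = {(x, a, acc :: 'c list). (x, a) \<in> E}"
  have "ptime D (\<lambda>x. fold (\<lambda>a acc. f x a # acc) (l x) [])"
  proof (rule ptime_fold[where E = F and step = "\<lambda>x a acc. f x a # acc" and q = "[:1, 1:] + [:0, 1:] * q"])
    have "ptime F (\<lambda>z. f (fst (fst z, fst (snd z))) (snd (fst z, fst (snd z))))"
      by (rule ptime_comp[OF _ f, of F "\<lambda>z. (fst z, fst (snd z))"])
         (intro ptime_intros, auto simp: F_def)
    then show "ptime F (\<lambda>z. f (fst z) (fst (snd z)) # snd (snd z))"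
      by (intro ptime_intros) simp
    fix x ys zs assume x: "x \<in> D" "l x = ys @ zs"
    let ?S = "sz (x, l x, [] :: 'c list)"
    have "sz (fold (\<lambda>a acc. f x a # acc) ys []) \<le> 1 + length ys * (1 + poly q ?S)"
      if "set ys \<subseteq> set (l x)" for ys
      using that
    proof (induction ys rule: rev_induct)
      case (snoc a ys)
      then have "(x, a) \<in> E" using E x by auto
      then have "sz (f x a) \<le> poly q (sz (x, a))" using q[of "(x, a)"] by simp
      also have "sz (x, a) \<le> ?S" using sz_member[of a "l x"] snoc.prems by simp
      then have "poly q (sz (x, a)) \<le> poly q ?S" by (rule poly_nat_mono)
      finally show ?case using snoc by simp
    qed simp
    then have "sz (fold (\<lambda>a acc. f x a # acc) ys []) \<le> 1 + length ys * (1 + poly q ?S)"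
      using x by simp
    also have "length ys \<le> ?S"
      using length_less_sz[of "l x"] x by simp
    then have "1 + length ys * (1 + poly q ?S) \<le> 1 + ?S * (1 + poly q ?S)"
      by (intro add_left_mono mult_right_mono) auto
    also have "\<dots> = poly ([:1, 1:] + [:0, 1:] * q) ?S" by (simp add: algebra_simps)
    finally show "sz (fold (\<lambda>a acc. f x a # acc) ys []) \<le> poly ([:1, 1:] + [:0, 1:] * q) ?S" .
  qed (intro ptime_intros l | auto simp: F_def E)+
  then have "ptime D (\<lambda>x. rev (fold (\<lambda>a acc. f x a # acc) (l x) []))"
    by (rule ptime_rev)
  moreover have "rev (fold (\<lambda>a acc. g a # acc) as bs) = rev bs @ map g as"
    for g :: "'b \<Rightarrow> 'c" and as bs by (induction as arbitrary: bs) auto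
  ultimately show ?thesis by simp
qed

lemmas ptime_map_total = ptime_map[where E = UNIV, simplified]

lemma ptime_filter:
  assumes "ptime D l" "ptime UNIV (\<lambda>z. p (fst z) (snd z))"
  shows "ptime D (\<lambda>x. filter (p x) (l x))"
proof (rule ptime_cong)
  show "ptime D (\<lambda>x. concat (map (\<lambda>a. if p x a then [a] else []) (l x)))"
    by (intro ptime_intros ptime_map_total assms)
  have "filter P xs = concat (map (\<lambda>a. if P a then [a] else []) xs)" for P :: "'b \<Rightarrow> bool" and xs
    by (induction xs) auto
  then show "filter (p x) (l x) = concat (map (\<lambda>a. if p x a then [a] else []) (l x))" for x .
qed

lemma ptime_product [ptime_intros]:
  assumes "ptime D f" "ptime D g"
  shows "ptime D (\<lambda>x. List.product (f x) (g x))"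
proof -
  have "ptime UNIV (\<lambda>w :: 'b list \<times> 'c list. concat (map (\<lambda>a. map (\<lambda>b. (a, b)) (snd w)) (fst w)))"
    by (intro ptime_intros ptime_map_total)
  from ptime_comp[OF ptime_Pair[OF assms] this] show ?thesis
    by (simp add: product_concat_map)
qed


subsection \<open>Binary arithmetic\<close>

lemma enc_nat: "enc n = (if n = 0 then Leaf else Node (enc (odd n)) (enc (n div 2)))" for n :: nat
  unfolding enc_nat_def enc_bool_def by (rule nat_tree.simps)

lemma enc_nat_0 [simp]: "enc (0::nat) = Leaf"
  by (subst enc_nat) simp

lemma enc_nat_eq_Leaf [simp]: "enc n = Leaf \<longleftrightarrow> n = 0" for n :: nat
  by (subst enc_nat) simp

text \<open>A binary digit takes at most four nodes, one for the list cell and three for the bit 1;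
  the final \<open>Leaf\<close> adds one.\<close>

lemma sz_nat_le:
  assumes "n < 2 ^ L" shows "sz (n::nat) \<le> 4 * L + 1"
  using assms
proof (induction L arbitrary: n)
  case (Suc L)
  then have "sz (n div 2) \<le> 4 * L + 1" by auto
  moreover have "sz (odd n) \<le> 3" by (cases "odd n") auto
  ultimately show ?case by (subst enc_nat) auto
qed simp

lemma nat_less_sz: "(n::nat) < 2 ^ sz n"
proof (induction n rule: less_induct)
  case (less n)
  show ?case
  proof (cases "n = 0")
    case False
    then have IH: "n div 2 < 2 ^ sz (n div 2)" using less by simp
    have "sz n = 1 + sz (odd n) + sz (n div 2)" using False by (subst enc_nat) simp
    then have "Suc (sz (n div 2)) \<le> sz n" using sz_pos[of "odd n"] by linarith
    then have "(2::nat) ^ Suc (sz (n div 2)) \<le> 2 ^ sz n" by (rule power_increasing) simp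
    moreover have "n < 2 ^ Suc (sz (n div 2))" using IH by auto
    ultimately show ?thesis by linarith
  qed simp
qed

text \<open>Code size is not monotone, because a digit 1 takes more nodes than a digit 0: the code
  of 7 is larger than that of 8. So the bound goes through a power of two above
  \<open>n\<close>.\<close>

lemma sz_nat_mono: "m \<le> n \<Longrightarrow> sz (m::nat) \<le> 4 * sz n + 1"
  using sz_nat_le[of m "sz n"] nat_less_sz[of n] by simp

lemma ptime_nat_eq_0 [ptime_intros]:
  fixes f :: "'a::enc \<Rightarrow> nat"
  assumes "ptime D f" shows "ptime D (\<lambda>x. f x = 0)"
proof -
  have "ptime D (\<lambda>x. if f x \<noteq> 0 then False else True)"
    by (rule ptime_test[OF assms]) (auto intro: ptime_const)
  then show ?thesis by (rule ptime_cong) simp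
qed

lemma ptime_odd [ptime_intros]:
  fixes f :: "'a::enc \<Rightarrow> nat"
  shows "ptime D f \<Longrightarrow> ptime D (\<lambda>x. odd (f x))"
  by (rule ptime_recode[OF ptime_tree_hd]) (auto simp: enc_nat[of "f _"])

lemma ptime_div2 [ptime_intros]:
  fixes f :: "'a::enc \<Rightarrow> nat"
  shows "ptime D f \<Longrightarrow> ptime D (\<lambda>x. f x div 2)"
  by (rule ptime_recode[OF ptime_tree_tl]) (auto simp: enc_nat[of "f _"])

text \<open>Appends a least significant digit, so \<open>fold dbl\<close> evaluates a digit list
  whose head is the most significant digit.\<close>

definition dbl :: "bool \<Rightarrow> nat \<Rightarrow> nat" where
  "dbl b n = 2 * n + of_bool b"

lemma ptime_dbl [ptime_intros]:
  assumes "ptime D b" "ptime D f" shows "ptime D (\<lambda>x. dbl (b x) (f x))"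
proof (rule ptime_recode)
  \<comment> \<open>Numerals have no leading zeros, so doubling 0 must give \<open>Leaf\<close> and
    not a cell with digit 0.\<close>
  show "ptime D (\<lambda>x. if \<not> b x \<and> f x = 0 then Leaf else Node (enc (b x)) (enc (f x)))"
    by (intro ptime_intros ptime_Node assms)
  show "enc (dbl (b x) (f x)) =
      enc (if \<not> b x \<and> f x = 0 then Leaf else Node (enc (b x)) (enc (f x)))" for x
    by (subst enc_nat) (auto simp: dbl_def)
qed

fun bits :: "nat \<Rightarrow> bool list" where
  "bits n = (if n = 0 then [] else odd n # bits (n div 2))"

declare bits.simps [simp del]

text \<open>A numeral already is the list of its digits, so passing to digits is free. The way back
  is not, because a digit list may contain leading zeros; \<open>fold dbl\<close> removes
  them.\<close>

lemma enc_bits: "enc (bits n) = enc n"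
proof (induction n rule: bits.induct)
  case (1 n)
  then show ?case by (subst bits.simps, subst enc_nat) simp
qed

lemma ptime_bits [ptime_intros]: "ptime D f \<Longrightarrow> ptime D (\<lambda>x. bits (f x))"
  by (rule ptime_recode) (auto simp: enc_bits)

lemma less_length_bits: "n < 2 ^ length (bits n)"
proof (induction n rule: bits.induct)
  case (1 n)
  then show ?case by (subst bits.simps) auto
qed

section \<open>Binary addition\<close>

lemma fold_const: "fold (\<lambda>_. f) xs = f ^^ length xs"
  by (induction xs) (auto simp: funpow_swap1 fun_eq_iff)

text \<open>The state holds the unread parts of both operands, the carry, and the output digits with
  the latest, hence most significant, one first. A nested equivalence of three bits is their sum
  modulo 2.\<close>

definition add_step :: "nat \<times> nat \<times> bool \<times> bool list \<Rightarrow> nat \<times> nat \<times> bool \<times> bool list" where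
  "add_step s =
    (fst s div 2, fst (snd s) div 2,
     odd (fst s) \<and> odd (fst (snd s)) \<or> (odd (fst s) \<or> odd (fst (snd s))) \<and> fst (snd (snd s)),
     (odd (fst s) \<longleftrightarrow> (odd (fst (snd s)) \<longleftrightarrow> fst (snd (snd s)))) # snd (snd (snd s)))"

text \<open>The list only counts rounds: enough for all digits of both operands, and one more for a
  last carry.\<close>

definition add_run :: "nat \<Rightarrow> nat \<Rightarrow> nat \<times> nat \<times> bool \<times> bool list" where
  "add_run x y = (add_step ^^ length (True # bits x @ bits y)) (x, y, False, [])"

text \<open>The invariant of schoolbook addition: the written digits, with the rest of the operands
  and the carry as upper part, always denote the original sum.\<close>

lemma add_steps:
  assumes "(add_step ^^ n) (x, y, c, out) = (x', y', c', out')"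
  shows "x' = x div 2 ^ n" "y' = y div 2 ^ n"
    "fold dbl out' (x' + y' + of_bool c') = fold dbl out (x + y + of_bool c)"
proof -
  have "x' = x div 2 ^ n \<and> y' = y div 2 ^ n \<and>
    fold dbl out' (x' + y' + of_bool c') = fold dbl out (x + y + of_bool c)"
    using assms
  proof (induction n arbitrary: x' y' c' out')
    case (Suc n)
    obtain u v d os where s: "(add_step ^^ n) (x, y, c, out) = (u, v, d, os)"
      by (metis prod_cases4)
    then have *: "u = x div 2 ^ n" "v = y div 2 ^ n"
      "fold dbl os (u + v + of_bool d) = fold dbl out (x + y + of_bool c)"
      using Suc.IH by auto
    have "(x', y', c', out') = add_step (u, v, d, os)" using Suc.prems s by simp
    then have **: "x' = u div 2" "y' = v div 2" "c' = (odd u \<and> odd v \<or> (odd u \<or> odd v) \<and> d)"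
      "out' = (odd u \<longleftrightarrow> (odd v \<longleftrightarrow> d)) # os"
      by (auto simp: add_step_def)
    have "dbl (odd u \<longleftrightarrow> (odd v \<longleftrightarrow> d)) (x' + y' + of_bool c') = u + v + of_bool d"
      unfolding ** dbl_def by (cases d; cases "odd u"; cases "odd v"; simp; presburger)
    then show ?case using * **(1,2,4) by (simp add: div_mult2_eq power_Suc2 del: power_Suc)
  qed simp
  then show "x' = x div 2 ^ n" "y' = y div 2 ^ n"
    "fold dbl out' (x' + y' + of_bool c') = fold dbl out (x + y + of_bool c)" by auto
qed

lemma less_power_bits:
  "x < 2 ^ length (bits x @ bits y)" "y < 2 ^ length (bits x @ bits y)"
proof -
  have "(2::nat) ^ length (bits x) \<le> 2 ^ length (bits x @ bits y)"
    "(2::nat) ^ length (bits y) \<le> 2 ^ length (bits x @ bits y)"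
    by (auto intro!: power_increasing)
  then show "x < 2 ^ length (bits x @ bits y)" "y < 2 ^ length (bits x @ bits y)"
    using less_length_bits[of x] less_length_bits[of y] by linarith+
qed

lemma add_run: "fold dbl (snd (snd (snd (add_run x y)))) 0 = x + y"
proof -
  let ?n = "length (bits x @ bits y)"
  obtain u v d os where s: "(add_step ^^ ?n) (x, y, False, []) = (u, v, d, os)"
    by (metis prod_cases4)
  have uv: "u = 0" "v = 0" using add_steps(1,2)[OF s] less_power_bits(1)[of x y] less_power_bits(2)[of y x] by auto
  obtain u' v' d' os' where s': "add_run x y = (u', v', d', os')"
    by (metis prod_cases4)
  \<comment> \<open>With both operands used up, the additional round moves the carry into the output
    and leaves the upper part 0.\<close>
  have "add_run x y = add_step (u, v, d, os)"
    unfolding add_run_def using s by simp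
  then have "u' = 0" "v' = 0" "\<not> d'" using uv s' by (auto simp: add_step_def)
  then show ?thesis using add_steps(3)[OF s'[unfolded add_run_def]] s' by simp
qed

lemma sz_bool_le: "sz (b::bool) \<le> 3"
  by (cases b) auto

lemma sz_div2_le: "sz (n div 2) \<le> sz n" for n :: nat
  by (subst (2) enc_nat) auto

lemma ptime_dbl_fold [ptime_intros]:
  assumes "ptime D f" shows "ptime D (\<lambda>x. fold dbl (f x) 0)"
proof -
  have "sz (dbl a acc) \<le> sz acc + poly [:4:] (sz x + sz a)" for a acc and x :: 'a
    using sz_bool_le[of "odd (dbl a acc)"] sz_bool_le[of True] by (subst enc_nat) (auto simp: dbl_def)
  then show ?thesis
    by (intro ptime_fold_additive[of D f "\<lambda>_. 0" "\<lambda>_. dbl" "[:4:]"] ptime_intros assms)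
qed

lemma ptime_add [ptime_intros]:
  assumes "ptime D f" "ptime D g" shows "ptime D (\<lambda>x. f x + g x :: nat)"
proof -
  have bound: "sz (add_step s) \<le> sz s + poly [:6:] (sz x + sz a)" for s and a :: bool and x :: 'a
  proof -
    obtain u v d os where s: "s = (u, v, d, os)" by (metis prod_cases4)
    obtain d' e where "add_step s = (u div 2, v div 2, d', e # os)"
      by (simp add: s add_step_def)
    then show ?thesis
      using sz_bool_le[of d'] sz_bool_le[of e] sz_div2_le[of u] sz_div2_le[of v] sz_pos[of d]
      by (simp add: s)
  qed
  have "ptime D (\<lambda>x. fold (\<lambda>_. add_step) (True # bits (f x) @ bits (g x)) (f x, g x, False, []))"
  proof (rule ptime_fold_additive[where step = "\<lambda>_ _. add_step", OF _ _ _ bound])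
    show "ptime UNIV (\<lambda>z. add_step (snd (snd z)))"
      unfolding add_step_def by (intro ptime_intros)
  qed (intro ptime_intros assms)+
  then have "ptime D (\<lambda>x. add_run (f x) (g x))"
    by (simp add: fold_const add_run_def)
  then have "ptime D (\<lambda>x. fold dbl (snd (snd (snd (add_run (f x) (g x))))) 0)"
    by (intro ptime_intros)
  then show ?thesis by (simp add: add_run)
qed

section \<open>Binary subtraction and comparison\<close>

definition sub_step :: "nat \<times> nat \<times> bool \<times> bool list \<Rightarrow> nat \<times> nat \<times> bool \<times> bool list" where
  "sub_step s =
    (fst s div 2, fst (snd s) div 2,
     \<not> odd (fst s) \<and> (odd (fst (snd s)) \<or> fst (snd (snd s))) \<or> odd (fst (snd s)) \<and> fst (snd (snd s)),
     (odd (fst s) \<longleftrightarrow> (odd (fst (snd s)) \<longleftrightarrow> fst (snd (snd s)))) # snd (snd (snd s)))"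

text \<open>No extra round as in \<open>add_run\<close>: the borrow left at the end is itself the
  answer to the comparison.\<close>

definition sub_run :: "nat \<Rightarrow> nat \<Rightarrow> nat \<times> nat \<times> bool \<times> bool list" where
  "sub_run x y = (sub_step ^^ length (bits x @ bits y)) (x, y, False, [])"

text \<open>The counterpart of \<open>dbl\<close> on integers, since a pending borrow can make the
  upper part in the invariant negative.\<close>

definition int_dbl :: "bool \<Rightarrow> int \<Rightarrow> int" where
  "int_dbl b n = 2 * n + of_bool b"

lemma sub_steps:
  assumes "(sub_step ^^ n) (x, y, c, out) = (x', y', c', out')"
  shows "x' = x div 2 ^ n" "y' = y div 2 ^ n"
    "fold int_dbl out' (int x' - int y' - of_bool c') = fold int_dbl out (int x - int y - of_bool c)"
proof -
  have "x' = x div 2 ^ n \<and> y' = y div 2 ^ n \<and>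
    fold int_dbl out' (int x' - int y' - of_bool c') = fold int_dbl out (int x - int y - of_bool c)"
    using assms
  proof (induction n arbitrary: x' y' c' out')
    case (Suc n)
    obtain u v d os where s: "(sub_step ^^ n) (x, y, c, out) = (u, v, d, os)"
      by (metis prod_cases4)
    then have *: "u = x div 2 ^ n" "v = y div 2 ^ n"
      "fold int_dbl os (int u - int v - of_bool d) = fold int_dbl out (int x - int y - of_bool c)"
      using Suc.IH by auto
    have "(x', y', c', out') = sub_step (u, v, d, os)" using Suc.prems s by simp
    then have **: "x' = u div 2" "y' = v div 2" "c' = (\<not> odd u \<and> (odd v \<or> d) \<or> odd v \<and> d)"
      "out' = (odd u \<longleftrightarrow> (odd v \<longleftrightarrow> d)) # os"
      by (auto simp: sub_step_def)
    have "int u = 2 * int (u div 2) + of_bool (odd u)" for u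
      by (cases "odd u") (simp_all, presburger+)
    from this[of u] this[of v] have "int_dbl (odd u \<longleftrightarrow> (odd v \<longleftrightarrow> d)) (int x' - int y' - of_bool c') = int u - int v - of_bool d"
      unfolding ** int_dbl_def by (cases d; cases "odd u"; cases "odd v"; simp)
    then show ?case using * **(1,2,4) by (simp add: div_mult2_eq power_Suc2 del: power_Suc)
  qed simp
  then show "x' = x div 2 ^ n" "y' = y div 2 ^ n"
    "fold int_dbl out' (int x' - int y' - of_bool c') = fold int_dbl out (int x - int y - of_bool c)" by auto
qed

lemma int_dbl_neg: "v < 0 \<Longrightarrow> fold int_dbl bs v < 0"
  by (induction bs arbitrary: v) (auto simp: int_dbl_def)

lemma int_dbl_nat: "fold int_dbl bs (int v) = int (fold dbl bs v)"
proof (induction bs arbitrary: v)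
  case (Cons b bs)
  have "int_dbl b (int v) = int (dbl b v)" by (simp add: int_dbl_def dbl_def)
  then show ?case using Cons by simp
qed simp

text \<open>When the operands are used up, the upper part is 0 without and -1 with a borrow. A
  negative sign survives appending digits, so the borrow decides the comparison; without a borrow
  the digits denote the difference.\<close>

lemma sub_run:
  "fst (snd (snd (sub_run x y))) \<longleftrightarrow> x < y"
  "\<not> x < y \<Longrightarrow> fold dbl (snd (snd (snd (sub_run x y)))) 0 = x - y"
proof -
  obtain u v d os where s: "sub_run x y = (u, v, d, os)"
    by (metis prod_cases4)
  note st = sub_steps[OF s[unfolded sub_run_def]]
  have uv: "u = 0" "v = 0" using st(1,2) less_power_bits(1)[of x y] less_power_bits(2)[of y x] by auto
  have eq: "fold int_dbl os (- of_bool d) = int x - int y" using st(3) uv by simp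
  have d: "d \<longleftrightarrow> x < y"
  proof (cases d)
    case True
    then show ?thesis using eq int_dbl_neg[of "-1" os] by simp
  next
    case False
    then show ?thesis using eq int_dbl_nat[of os 0] by simp
  qed
  then show "fst (snd (snd (sub_run x y))) \<longleftrightarrow> x < y" by (simp add: s)
  assume "\<not> x < y"
  then have "int (fold dbl os 0) = int x - int y" using eq d int_dbl_nat[of os 0] by simp
  then show "fold dbl (snd (snd (snd (sub_run x y)))) 0 = x - y" by (simp add: s)
qed

lemma ptime_sub_run:
  assumes "ptime D f" "ptime D g" shows "ptime D (\<lambda>x. sub_run (f x) (g x))"
proof -
  have bound: "sz (sub_step s) \<le> sz s + poly [:6:] (sz x + sz a)" for s and a :: bool and x :: 'a
  proof -
    obtain u v d os where s: "s = (u, v, d, os)" by (metis prod_cases4)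
    obtain d' e where "sub_step s = (u div 2, v div 2, d', e # os)"
      by (simp add: s sub_step_def)
    then show ?thesis
      using sz_bool_le[of d'] sz_bool_le[of e] sz_div2_le[of u] sz_div2_le[of v] sz_pos[of d]
      by (simp add: s)
  qed
  have "ptime D (\<lambda>x. fold (\<lambda>_. sub_step) (bits (f x) @ bits (g x)) (f x, g x, False, []))"
  proof (rule ptime_fold_additive[where step = "\<lambda>_ _. sub_step", OF _ _ _ bound])
    show "ptime UNIV (\<lambda>z. sub_step (snd (snd z)))"
      unfolding sub_step_def by (intro ptime_intros)
  qed (intro ptime_intros assms)+
  then show ?thesis
    by (simp add: fold_const sub_run_def)
qed

lemma ptime_less [ptime_intros]:
  assumes "ptime D f" "ptime D g" shows "ptime D (\<lambda>x. f x < (g x :: nat))"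
proof -
  have "ptime D (\<lambda>x. fst (snd (snd (sub_run (f x) (g x)))))"
    by (intro ptime_intros ptime_sub_run assms)
  then show ?thesis by (simp add: sub_run(1))
qed

lemma ptime_eq [ptime_intros]:
  assumes "ptime D f" "ptime D g" shows "ptime D (\<lambda>x. f x = (g x :: nat))"
proof (rule ptime_cong)
  show "ptime D (\<lambda>x. \<not> f x < g x \<and> \<not> g x < f x)" by (intro ptime_intros assms)
qed auto

lemma ptime_diff [ptime_intros]:
  assumes "ptime D f" "ptime D g" shows "ptime D (\<lambda>x. f x - g x :: nat)"
proof (rule ptime_cong)
  show "ptime D (\<lambda>x. if f x < g x then 0 else fold dbl (snd (snd (snd (sub_run (f x) (g x))))) 0)"
    by (intro ptime_intros ptime_sub_run assms)
qed (auto simp: sub_run(2))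

lemma fold_dbl_bits: "fold dbl (rev (bits n)) 0 = n"
proof (induction n rule: bits.induct)
  case (1 n)
  have "dbl (odd n) (n div 2) = n" by (simp add: dbl_def)
  then show ?case using 1 by (subst bits.simps) simp
qed

text \<open>Horner's scheme over the digits of one factor, most significant first: double, and add
  the other factor if the digit is 1. That factor must be at hand in every round, so the context is
  the pair of \<open>x\<close> and \<open>g x\<close>.\<close>

lemma ptime_mult [ptime_intros]:
  assumes "ptime D f" "ptime D g" shows "ptime D (\<lambda>x. f x * g x :: nat)"
proof -
  define step where "step = (\<lambda>(x::'a, y) b acc. if b then dbl False acc + y else dbl False acc)"
  have step: "fold (step w) bs 0 = snd w * fold dbl bs 0" for w bs
    by (induction bs rule: rev_induct) (auto simp: step_def dbl_def algebra_simps split: prod.splits)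
  have less: "fold dbl bs 0 < 2 ^ length bs" for bs
    by (induction bs rule: rev_induct) (auto simp: dbl_def)
  have "ptime ((\<lambda>x. (x, g x)) ` D) (\<lambda>w. fold (step w) (rev (bits (f (fst w)))) 0)"
  proof (rule ptime_fold[where E = UNIV and q = "[:1, 8:]"])
    have "ptime ((\<lambda>x. (x, g x)) ` D) (\<lambda>x. f (fst x))"
      by (rule ptime_comp[OF _ assms(1)]) (auto intro: ptime_intros)
    then show "ptime ((\<lambda>x. (x, g x)) ` D) (\<lambda>x. rev (bits (f (fst x))))"
      by (intro ptime_intros)
    show "ptime UNIV (\<lambda>z. step (fst z) (fst (snd z)) (snd (snd z)))"
      unfolding step_def case_prod_beta by (intro ptime_intros)
    fix w :: "'a \<times> nat" and bs cs assume "rev (bits (f (fst w))) = bs @ cs"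
    \<comment> \<open>The accumulator is the factor times a number of \<open>length bs\<close>
      digits; bounding its value bounds its number of digits.\<close>
    have "fold (step w) bs 0 < 2 ^ (sz (snd w) + length bs)"
      unfolding step power_add using less nat_less_sz by (intro mult_strict_mono) auto
    then have "sz (fold (step w) bs 0) \<le> 4 * (sz (snd w) + length bs) + 1"
      by (rule sz_nat_le)
    also have "length bs \<le> length (bits (f (fst w)))"
      using arg_cong[OF \<open>rev (bits (f (fst w))) = bs @ cs\<close>, of length] by simp
    also have "length (bits (f (fst w))) \<le> sz (rev (bits (f (fst w))))"
      using length_less_sz[of "rev (bits (f (fst w)))"] by simp
    finally show "sz (fold (step w) bs 0) \<le> poly [:1, 8:] (sz (w, rev (bits (f (fst w))), 0::nat))"
      by (cases w) simp
  qed (auto intro: ptime_intros)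
  then have "ptime D (\<lambda>x. fold (step (x, g x)) (rev (bits (f (fst (x, g x))))) 0)"
    by (rule ptime_comp[rotated]) (auto intro: ptime_intros assms)
  then show ?thesis by (simp add: step fold_dbl_bits mult.commute)
qed

lemma ptime_sum_list [ptime_intros]:
  assumes "ptime D f" shows "ptime D (\<lambda>x. sum_list (f x) :: nat)"
proof -
  \<comment> \<open>Sizes add up along a list, so all partial sums have at most linearly many
    digits.\<close>
  have "sum_list xs < 2 ^ sz xs" for xs :: "nat list"
  proof (induction xs)
    case (Cons a xs)
    have "sum_list (a # xs) < 2 ^ sz a + 2 ^ sz xs" using Cons nat_less_sz[of a] by simp
    also have "(2::nat) ^ sz a \<le> 2 ^ (sz a + sz xs)" by (intro power_increasing) auto
    also have "(2::nat) ^ sz xs \<le> 2 ^ (sz a + sz xs)" by (intro power_increasing) auto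
    finally show ?case by (simp add: mult_2)
  qed simp
  then have sz: "sz (sum_list xs) \<le> 4 * sz xs + 1" for xs :: "nat list"
    by (rule sz_nat_le)
  have fold: "fold (\<lambda>a acc. a + acc) xs 0 = sum_list xs" for xs :: "nat list"
    by (simp add: fold_plus_sum_list_rev)
  have "ptime D (\<lambda>x. fold (\<lambda>a acc. a + acc) (f x) 0)"
  proof (rule ptime_fold[where E = UNIV and step = "\<lambda>_ a acc. a + acc" and q = "[:1, 4:]"])
    fix x ys zs assume "f x = ys @ zs"
    then have "sz ys \<le> sz (f x)" using sz_append[of ys zs] sz_pos[of zs] by simp
    then show "sz (fold (\<lambda>a acc. a + acc) ys 0) \<le> poly [:1, 4:] (sz (x, f x, 0::nat))"
      using sz[of ys] by (simp add: fold)
  qed (intro ptime_intros assms UNIV_I)+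
  then show ?thesis by (simp add: fold)
qed


subsection \<open>Integers\<close>

lemma enc_int: "enc i = Node (enc (i < 0)) (enc (nat \<bar>i\<bar>))"
  by (simp add: enc_int_def int_tree_def enc_bool_def enc_nat_def)

lemma ptime_int_neg [ptime_intros]:
  fixes f :: "'a::enc \<Rightarrow> int"
  shows "ptime D f \<Longrightarrow> ptime D (\<lambda>x. f x < 0)"
  by (rule ptime_recode[OF ptime_tree_hd]) (auto simp: enc_int[of "f _"])

lemma ptime_nat_abs [ptime_intros]:
  "ptime D f \<Longrightarrow> ptime D (\<lambda>x. nat \<bar>f x\<bar>)"
  by (rule ptime_recode[OF ptime_tree_tl]) (auto simp: enc_int[of "f _"])

definition signed :: "bool \<Rightarrow> nat \<Rightarrow> int" where
  "signed b n = (if b then - int n else int n)"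

lemma ptime_signed [ptime_intros]:
  assumes "ptime D b" "ptime D f" shows "ptime D (\<lambda>x. signed (b x) (f x))"
proof (rule ptime_recode)
  \<comment> \<open>The code of zero carries the sign \<open>False\<close>, whatever sign is
    requested.\<close>
  show "ptime D (\<lambda>x. (b x \<and> \<not> f x = 0, f x))" by (intro ptime_intros assms)
  show "enc (signed (b x) (f x)) = enc (b x \<and> \<not> f x = 0, f x)" for x
    by (simp add: enc_int signed_def)
qed

lemma ptime_uminus [ptime_intros]:
  assumes "ptime D f" shows "ptime D (\<lambda>x. - f x :: int)"
proof (rule ptime_cong)
  show "ptime D (\<lambda>x. signed (\<not> f x < 0) (nat \<bar>f x\<bar>))" by (intro ptime_intros assms)
qed (auto simp: signed_def)

lemma ptime_of_nat [ptime_intros]: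
  assumes "ptime D f" shows "ptime D (\<lambda>x. int (f x))"
proof (rule ptime_cong)
  show "ptime D (\<lambda>x. signed False (f x))" by (intro ptime_intros assms)
qed (auto simp: signed_def)

lemma ptime_int_mult [ptime_intros]:
  assumes "ptime D f" "ptime D g" shows "ptime D (\<lambda>x. f x * g x :: int)"
proof (rule ptime_cong)
  show "ptime D (\<lambda>x. signed (\<not> (f x < 0 \<longleftrightarrow> g x < 0)) (nat \<bar>f x\<bar> * nat \<bar>g x\<bar>))"
    by (intro ptime_intros assms)
qed (auto simp: signed_def nat_mult_distrib[symmetric] abs_mult[symmetric] mult_nonneg_nonpos mult_nonpos_nonneg mult_nonpos_nonpos)

lemma ptime_int_add [ptime_intros]:
  assumes "ptime D f" "ptime D g" shows "ptime D (\<lambda>x. f x + g x :: int)"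
proof (rule ptime_cong)
  show "ptime D (\<lambda>x. if f x < 0 \<longleftrightarrow> g x < 0 then signed (f x < 0) (nat \<bar>f x\<bar> + nat \<bar>g x\<bar>)
      else if nat \<bar>f x\<bar> < nat \<bar>g x\<bar> then signed (g x < 0) (nat \<bar>g x\<bar> - nat \<bar>f x\<bar>)
      else signed (f x < 0) (nat \<bar>f x\<bar> - nat \<bar>g x\<bar>))"
    by (intro ptime_intros assms)
qed (auto simp: signed_def)

lemma ptime_int_diff [ptime_intros]:
  assumes "ptime D f" "ptime D g" shows "ptime D (\<lambda>x. f x - g x :: int)"
  using ptime_int_add[OF assms(1) ptime_uminus[OF assms(2)]] by simp


section \<open>The reduction\<close>

subsection \<open>Rational arithmetic and force-field lookup\<close>

type_synonym fraction = "int \<times> nat"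

definition frac_val :: "fraction \<Rightarrow> real" where
  "frac_val z = of_int (fst z) / of_nat (snd z)"

definition frac_add :: "fraction \<Rightarrow> fraction \<Rightarrow> fraction" where
  "frac_add a b = (fst a * int (snd b) + fst b * int (snd a), snd a * snd b)"

text \<open>The numerator is literally a square, which shows the nonnegativity demanded by
  \<open>energy_inputs\<close> without any assumption on the fractions.\<close>

definition frac_sqdiff :: "fraction \<Rightarrow> fraction \<Rightarrow> fraction" where
  "frac_sqdiff a b =
    ((fst a * int (snd b) - fst b * int (snd a)) * (fst a * int (snd b) - fst b * int (snd a)),
     snd a * snd b * (snd a * snd b))"

type_synonym point = "fraction \<times> fraction \<times> fraction"

definition sqdist :: "point \<Rightarrow> point \<Rightarrow> fraction" where
  "sqdist p q = frac_add (frac_sqdiff (fst p) (fst q))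
     (frac_add (frac_sqdiff (fst (snd p)) (fst (snd q))) (frac_sqdiff (snd (snd p)) (snd (snd q))))"

lemma ptime_sqdist [ptime_intros]:
  "ptime D f \<Longrightarrow> ptime D g \<Longrightarrow> ptime D (\<lambda>x. sqdist (f x) (g x))"
  unfolding sqdist_def frac_add_def frac_sqdiff_def by (intro ptime_intros)

lemma frac_add:
  "0 < snd a \<Longrightarrow> 0 < snd b \<Longrightarrow> frac_val (frac_add a b) = frac_val a + frac_val b"
  "0 < snd a \<Longrightarrow> 0 < snd b \<Longrightarrow> 0 < snd (frac_add a b)"
  by (auto simp: frac_val_def frac_add_def field_simps)

lemma frac_sqdiff:
  "0 < snd a \<Longrightarrow> 0 < snd b \<Longrightarrow> frac_val (frac_sqdiff a b) = (frac_val a - frac_val b)\<^sup>2"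
  "0 < snd a \<Longrightarrow> 0 < snd b \<Longrightarrow> 0 < snd (frac_sqdiff a b)"
  by (auto simp: frac_val_def frac_sqdiff_def power2_eq_square field_simps)

type_synonym parameters = "(nat \<times> nat \<times> fraction list) list"

text \<open>Pairs of species are unordered, so both orders match. Of several matching entries the
  last one wins; in a valid code all of them denote the same parameters. The default
  \<open>[]\<close> has no denominators and so is a legal argument of the energy program
  too.\<close>

definition lookup :: "parameters \<Rightarrow> nat \<Rightarrow> nat \<Rightarrow> fraction list" where
  "lookup ps s t = fold (\<lambda>e \<theta>. if fst e = s \<and> fst (snd e) = t \<or> fst e = t \<and> fst (snd e) = s
     then snd (snd e) else \<theta>) ps []"

lemma ptime_lookup [ptime_intros]:
  assumes "ptime D f" "ptime D g" "ptime D h"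
  shows "ptime D (\<lambda>x. lookup (f x) (g x) (h x))"
proof -
  define step where "step = (\<lambda>(w :: parameters \<times> nat \<times> nat) (e :: nat \<times> nat \<times> fraction list) \<theta>.
    if fst e = fst (snd w) \<and> fst (snd e) = snd (snd w) \<or> fst e = snd (snd w) \<and> fst (snd e) = fst (snd w)
     then snd (snd e) else \<theta>)"
  have "ptime UNIV (\<lambda>w. fold (step w) (fst w) [])"
  proof (rule ptime_fold_additive)
    show "ptime UNIV (\<lambda>z. step (fst z) (fst (snd z)) (snd (snd z)))"
      unfolding step_def by (intro ptime_intros)
    show "sz (step w e \<theta>) \<le> sz \<theta> + poly [:0, 1:] (sz w + sz e)" for w e \<theta>
      by (cases e) (simp add: step_def)
  qed (intro ptime_intros)+
  from ptime_comp[OF ptime_Pair[OF assms(1) ptime_Pair[OF assms(2,3)]] this]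
  show ?thesis by (simp add: lookup_def step_def)
qed

lemma lookup_cases:
  "lookup ps s t = [] \<and> \<not> (\<exists>e\<in>set ps. {fst e, fst (snd e)} = {s, t}) \<or>
   (\<exists>e\<in>set ps. {fst e, fst (snd e)} = {s, t} \<and> lookup ps s t = snd (snd e))"
proof (induction ps rule: rev_induct)
  case (snoc e ps)
  then show ?case
    by (auto simp: lookup_def doubleton_eq_iff)
qed (simp add: lookup_def)


subsection \<open>The constructed graph\<close>

type_synonym ion = "nat \<times> point \<times> fraction \<times> nat"

type_synonym instance_data = "(ion list \<times> parameters) \<times> nat \<times> fraction"

abbreviation ion_position :: "ion \<Rightarrow> point" where "ion_position v \<equiv> fst (snd v)"
abbreviation ion_charge :: "ion \<Rightarrow> fraction" where "ion_charge v \<equiv> fst (snd (snd v))"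
abbreviation ion_species :: "ion \<Rightarrow> nat" where "ion_species v \<equiv> snd (snd (snd v))"

definition ion_pairs :: "ion list \<Rightarrow> (ion \<times> ion) list" where
  "ion_pairs vs = filter (\<lambda>e. fst (fst e) < fst (snd e)) (List.product vs vs)"

definition energy_input :: "parameters \<Rightarrow> ion \<times> ion \<Rightarrow> fraction list \<times> fraction" where
  "energy_input ps e = (lookup ps (ion_species (fst e)) (ion_species (snd e)),
     sqdist (ion_position (fst e)) (ion_position (snd e)))"

definition bonus :: "(fraction list \<times> fraction \<Rightarrow> fraction) \<Rightarrow> instance_data \<Rightarrow> nat" where
  "bonus f w = 1 + nat \<bar>fst (snd (snd w))\<bar> +
     sum_list (map (\<lambda>e. nat \<bar>fst (f (energy_input (snd (fst w)) e))\<bar>) (ion_pairs (fst (fst w))))"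

text \<open>Over the denominator b of an energy a / b, the weight M - a / b has numerator M * b - a.
  Opposite charges show in the signs of the numerators, denominators being positive.\<close>

definition edge_entry ::
    "(fraction list \<times> fraction \<Rightarrow> fraction) \<Rightarrow> instance_data \<Rightarrow> ion \<times> ion \<Rightarrow> nat \<times> nat \<times> fraction" where
  "edge_entry f w e = (fst (fst e), fst (snd e),
     (if \<not> (fst (ion_charge (fst e)) < 0 \<longleftrightarrow> fst (ion_charge (snd e)) < 0)
        then int (bonus f w * snd (f (energy_input (snd (fst w)) e))) else 0)
       - fst (f (energy_input (snd (fst w)) e)),
     snd (f (energy_input (snd (fst w)) e)))"

text \<open>One step of dividing \<open>k\<close> by \<open>c\<close> through repeated subtraction.
  No more subtractions are wanted than there are positive ions, so the ion list itself can drive the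
  loop.\<close>

definition kept_step :: "nat \<Rightarrow> ion \<Rightarrow> nat \<times> nat \<Rightarrow> nat \<times> nat" where
  "kept_step c v s = (if fst (ion_charge v) < 0 then s
     else if fst s < c then (fst s, snd s + 1) else (fst s - c, snd s))"

text \<open>Charge \<open>k\<close> is removed ion by ion from the positive ions: the first component is the charge that
  remains to be removed, the second one the number of positive ions that are kept.\<close>

definition kept :: "nat \<Rightarrow> instance_data \<Rightarrow> nat \<times> nat" where
  "kept c w = fold (kept_step c) (fst (fst w)) (fst (snd w), 0)"

text \<open>A nonzero remainder means that no set of k-charges exists; the output is then the empty
  graph with clique size 1. Otherwise the threshold M * r^2 - g is written over the denominator of
  \<open>g\<close>.\<close>

definition clique_instance ::
    "nat \<Rightarrow> (fraction list \<times> fraction \<Rightarrow> fraction) \<Rightarrow> instance_data \<Rightarrow>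
      (nat list \<times> (nat \<times> nat \<times> fraction) list) \<times> nat \<times> fraction" where
  "clique_instance c f w = (if fst (kept c w) = 0
     then ((map fst (fst (fst w)), map (edge_entry f w) (ion_pairs (fst (fst w)))),
       2 * snd (kept c w),
       int (bonus f w * (snd (kept c w) * snd (kept c w)) * snd (snd (snd w))) - fst (snd (snd w)),
       snd (snd (snd w)))
     else (([], []), 1, 0, 1))"

text \<open>Data on which the given energy program is promised to halt. The second component is the
  square of a distance, as in \<open>distance_code\<close>.\<close>

definition energy_inputs :: "(fraction list \<times> fraction) set" where
  "energy_inputs = {(\<theta>, z). (\<forall>a\<in>set \<theta>. 0 < snd a) \<and> 0 < snd z \<and> 0 \<le> fst z}"

text \<open>A condition on the data alone, so that it can be a domain for \<open>ptime\<close>; it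
  ensures that the energy program is called on \<open>energy_inputs\<close> only.\<close>

definition well_formed :: "instance_data \<Rightarrow> bool" where
  "well_formed w \<longleftrightarrow>
    (\<forall>v\<in>set (fst (fst w)). 0 < snd (fst (ion_position v)) \<and> 0 < snd (fst (snd (ion_position v))) \<and>
       0 < snd (snd (snd (ion_position v)))) \<and>
    (\<forall>e\<in>set (snd (fst w)). \<forall>a\<in>set (snd (snd e)). 0 < snd a)"

lemma sqdist_nonneg: "0 \<le> fst (sqdist p q)"
  by (simp add: sqdist_def frac_add_def frac_sqdiff_def)

lemma energy_input_in:
  assumes "well_formed w" "e \<in> set (ion_pairs (fst (fst w)))"
  shows "energy_input (snd (fst w)) e \<in> energy_inputs"
proof -
  let ?v = "fst e" and ?u = "snd e"
  have "?v \<in> set (fst (fst w))" "?u \<in> set (fst (fst w))"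
    using assms(2) by (auto simp: ion_pairs_def)
  then have "0 < snd (sqdist (ion_position ?v) (ion_position ?u))"
    using assms(1) unfolding well_formed_def sqdist_def by (intro frac_add frac_sqdiff) auto
  moreover have "\<forall>a\<in>set (lookup (snd (fst w)) (ion_species ?v) (ion_species ?u)). 0 < snd a"
    using lookup_cases[of "snd (fst w)" "ion_species ?v" "ion_species ?u"] assms(1)
    unfolding well_formed_def by (metis empty_iff list.set(1))
  ultimately show ?thesis
    by (auto simp: energy_inputs_def energy_input_def sqdist_nonneg)
qed

lemma ptime_ion_pairs [ptime_intros]:
  "ptime D f \<Longrightarrow> ptime D (\<lambda>x. ion_pairs (f x))"
  unfolding ion_pairs_def by (intro ptime_intros ptime_filter)

lemma ptime_kept:
  "ptime D (\<lambda>w. kept c w)"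
proof -
  \<comment> \<open>The remaining charge never grows and the counter is at most the number of ions;
    both facts keep the state small.\<close>
  have inv: "fst (fold (kept_step c) vs s) \<le> fst s \<and> snd (fold (kept_step c) vs s) \<le> snd s + length vs" for vs s
  proof (induction vs arbitrary: s)
    case (Cons v vs)
    have "fst (kept_step c v s) \<le> fst s \<and> snd (kept_step c v s) \<le> snd s + 1"
      by (auto simp: kept_step_def)
    then show ?case using Cons[of "kept_step c v s"] by simp
  qed simp
  have "ptime D (\<lambda>w. fold (kept_step c) (fst (fst w)) (fst (snd w), 0))"
  proof (rule ptime_fold[where step = "\<lambda>_. kept_step c" and E = UNIV and q = "[:3, 8:]"])
    show "ptime UNIV (\<lambda>z :: instance_data \<times> ion \<times> nat \<times> nat. kept_step c (fst (snd z)) (snd (snd z)))"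
      unfolding kept_step_def by (intro ptime_intros)
    fix w :: instance_data and ys zs assume w: "fst (fst w) = ys @ (zs :: ion list)"
    let ?s = "fold (kept_step c) ys (fst (snd w), 0)"
    have "sz (fst ?s) \<le> 4 * sz (fst (snd w)) + 1"
      using inv[of ys "(fst (snd w), 0)"] by (intro sz_nat_mono) simp
    moreover have "snd ?s < 2 ^ length (fst (fst w))"
    proof -
      have "snd ?s \<le> length (fst (fst w))" using inv[of ys "(fst (snd w), 0)"] w by simp
      also have "\<dots> < 2 ^ length (fst (fst w))" by (rule less_exp)
      finally show ?thesis .
    qed
    then have "sz (snd ?s) \<le> 4 * length (fst (fst w)) + 1" by (rule sz_nat_le)
    moreover have "length (fst (fst w)) < sz (fst (fst w))" by (rule length_less_sz)
    moreover have "sz ?s = 1 + sz (fst ?s) + sz (snd ?s)" by (cases ?s) simp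
    ultimately show "sz ?s \<le> poly [:3, 8:] (sz (w, fst (fst w), (fst (snd w), 0::nat)))"
      by simp
  qed (auto intro!: ptime_intros)
  then show ?thesis unfolding kept_def .
qed

lemma ptime_clique_instance:
  assumes f: "ptime energy_inputs f"
  shows "ptime {w. well_formed w} (clique_instance c f)"
proof -
  let ?D = "{w. well_formed w}"
  \<comment> \<open>An instance together with one of its ion pairs: the context in which a single
    edge is computed.\<close>
  define E where "E = {(w, e). well_formed w \<and> e \<in> set (ion_pairs (fst (fst w)))}"
  have fE: "ptime E (\<lambda>z. f (energy_input (snd (fst (fst z))) (snd z)))"
  proof (rule ptime_comp[OF _ f])
    show "ptime E (\<lambda>z. energy_input (snd (fst (fst z))) (snd z))"
      unfolding energy_input_def by (intro ptime_intros)
  qed (auto simp: E_def intro: energy_input_in)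
  have bonus: "ptime ?D (bonus f)"
    unfolding bonus_def
    by (intro ptime_intros ptime_map[where E = E] fE) (auto simp: E_def)
  have "ptime E (\<lambda>z. bonus f (fst z))"
    by (rule ptime_comp[OF _ bonus]) (auto simp: E_def intro: ptime_intros)
  then have "ptime E (\<lambda>z. edge_entry f (fst z) (snd z))"
    unfolding edge_entry_def by (intro ptime_intros fE)
  then have "ptime ?D (\<lambda>w. map (edge_entry f w) (ion_pairs (fst (fst w))))"
    by (intro ptime_map[where E = E] ptime_intros) (auto simp: E_def)
  moreover have "ptime ?D (\<lambda>w. map fst (fst (fst w)))"
    by (intro ptime_map_total ptime_intros)
  ultimately show ?thesis
    unfolding clique_instance_def by (intro ptime_intros ptime_kept bonus)
qed


subsection \<open>Cliques of the complete graph on the ions\<close>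

definition opposite :: "crystal \<Rightarrow> nat \<Rightarrow> nat \<Rightarrow> bool" where
  "opposite X i j \<longleftrightarrow> \<not> (0 < charge X i \<longleftrightarrow> 0 < charge X j)"

definition ion_weight :: "energy_function \<Rightarrow> crystal \<Rightarrow> real \<Rightarrow> nat \<Rightarrow> nat \<Rightarrow> real" where
  "ion_weight F X M i j = (if opposite X i j then M else 0) - pair_energy F X i j"

text \<open>Edges are sets, while energies are summed over \<open>i < j\<close>; \<open>Min\<close>
  and \<open>Max\<close> recover that order.\<close>

definition ion_graph :: "energy_function \<Rightarrow> crystal \<Rightarrow> real \<Rightarrow> weighted_graph" where
  "ion_graph F X M =
     \<lparr>vertices = ions X, edges = (\<lambda>(i, j). {i, j}) ` {(i, j). i \<in> ions X \<and> j \<in> ions X \<and> i < j},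
      weight = (\<lambda>e. ion_weight F X M (Min e) (Max e))\<rparr>"

lemma pairs_finite: "finite C \<Longrightarrow> finite {(i :: nat, j). i \<in> C \<and> j \<in> C \<and> i < j}"
  by (rule finite_subset[of _ "C \<times> C"]) auto

lemma graph_ion_graph: "finite (ions X) \<Longrightarrow> graph (ion_graph F X M)"
  by (auto simp: graph_def ion_graph_def)

lemma clique_ion_graph: "clique (ion_graph F X M) C \<longleftrightarrow> C \<subseteq> ions X"
proof -
  have "{u, v} \<in> edges (ion_graph F X M)" if "u \<in> ions X" "v \<in> ions X" "u \<noteq> v" for u v
  proof (cases "u < v")
    case True
    then show ?thesis using that by (auto simp: ion_graph_def intro!: image_eqI[of _ _ "(u, v)"])
  next
    case False
    then show ?thesis using that by (auto simp: ion_graph_def intro!: image_eqI[of _ _ "(v, u)"])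
  qed
  moreover have "vertices (ion_graph F X M) = ions X" by (simp add: ion_graph_def)
  ultimately show ?thesis unfolding clique_def by (metis subsetD)
qed

text \<open>Exactly one end of such a pair satisfies \<open>P\<close>. Listing that end first,
  instead of the smaller one, gives a bijection with a product.\<close>

lemma card_unordered_pairs:
  fixes C :: "nat set"
  assumes C: "finite C"
  shows "card {(i, j). (i \<in> C \<and> j \<in> C \<and> i < j) \<and> \<not> (P i \<longleftrightarrow> P j)} =
    card {i\<in>C. P i} * card {i\<in>C. \<not> P i}"
proof -
  have "bij_betw (\<lambda>(a, b). (min a b, max a b)) ({i\<in>C. P i} \<times> {i\<in>C. \<not> P i})
      {(i, j). (i \<in> C \<and> j \<in> C \<and> i < j) \<and> \<not> (P i \<longleftrightarrow> P j)}"
    by (rule bij_betw_byWitness[where f' = "\<lambda>(i, j). if P i then (i, j) else (j, i)"])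
       (auto simp: min_def max_def split: if_splits, (metis nat_neq_iff not_less_iff_gr_or_eq le_less)+)
  from bij_betw_same_card[OF this] show ?thesis by (simp add: card_cartesian_product)
qed

lemma clique_weight_ion_graph:
  assumes C: "C \<subseteq> ions X" and fin: "finite (ions X)"
  shows "clique_weight (ion_graph F X M) C =
    M * real (card {v\<in>C. 0 < charge X v} * card {v\<in>C. \<not> 0 < charge X v}) - total_energy F X C"
proof -
  define I where "I = {(i, j). i \<in> C \<and> j \<in> C \<and> i < j}"
  have finC: "finite C" using C fin by (rule finite_subset)
  then have finI: "finite I" unfolding I_def by (rule pairs_finite)
  have edges: "{e \<in> edges (ion_graph F X M). e \<subseteq> C} = (\<lambda>(i, j). {i, j}) ` I"
    using C by (auto simp: ion_graph_def I_def image_iff)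
  have inj: "inj_on (\<lambda>(i, j). {i, j}) I"
    by (auto simp: inj_on_def I_def doubleton_eq_iff)
  have "clique_weight (ion_graph F X M) C = (\<Sum>(i, j)\<in>I. ion_weight F X M i j)"
    unfolding clique_weight_def edges sum.reindex[OF inj]
    by (rule sum.cong) (auto simp: I_def ion_graph_def)
  also have "\<dots> = (\<Sum>(i, j)\<in>I. if opposite X i j then M else 0) - (\<Sum>(i, j)\<in>I. pair_energy F X i j)"
    unfolding ion_weight_def sum_subtractf[symmetric] by (rule sum.cong) auto
  also have "(\<Sum>(i, j)\<in>I. if opposite X i j then M else 0) = (\<Sum>p\<in>I \<inter> {(i, j). opposite X i j}. M)"
    using sum.inter_restrict[OF finI, of "\<lambda>_. M" "{(i, j). opposite X i j}"]
    by (auto intro!: sum.cong)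
  also have "\<dots> = M * real (card (I \<inter> {(i, j). opposite X i j}))" by simp
  also have "I \<inter> {(i, j). opposite X i j} =
      {(i, j). (i \<in> C \<and> j \<in> C \<and> i < j) \<and> \<not> (0 < charge X i \<longleftrightarrow> 0 < charge X j)}"
    by (auto simp: I_def opposite_def)
  finally show ?thesis
    unfolding card_unordered_pairs[OF finC] total_energy_def I_def .
qed

text \<open>One factor is m + d and the other m - d with d > 0, so the product is m^2 - d^2.\<close>

lemma unbalanced_product:
  fixes p n m :: nat
  assumes "p + n = 2 * m" "p \<noteq> n"
  shows "p * n + 1 \<le> m * m"
proof -
  obtain d where d: "p = m + d \<and> n + d = m \<or> n = m + d \<and> p + d = m"
    using assms(1) by (metis add.commute add_diff_inverse_nat add_left_imp_eq mult_2 nat_le_linear group_cancel.add1 le_add_diff_inverse)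
  then have "d > 0" using assms(2) by auto
  have "m * m = p * n + d * d"
    using d by (auto simp: algebra_simps)
  moreover have "1 \<le> d * d" using \<open>d > 0\<close> by (simp add: Suc_leI)
  ultimately show ?thesis by simp
qed

lemma sum_charge:
  assumes "finite A" "\<forall>v\<in>A. charge X v = real c \<or> charge X v = - real c" "\<forall>v\<in>A. charge X v \<noteq> 0"
  shows "sum (charge X) A = real c * (real (card {v\<in>A. 0 < charge X v}) - real (card {v\<in>A. \<not> 0 < charge X v}))"
    "sum (charge X) (positive_part X A) = real c * real (card {v\<in>A. 0 < charge X v})"
proof -
  have pos: "sum (charge X) {v\<in>A. 0 < charge X v} = real c * real (card {v\<in>A. 0 < charge X v})"
  proof -
    have "sum (charge X) {v\<in>A. 0 < charge X v} = (\<Sum>v\<in>{v\<in>A. 0 < charge X v}. real c)"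
      using assms(2) by (intro sum.cong) auto
    then show ?thesis by simp
  qed
  have neg: "sum (charge X) {v\<in>A. \<not> 0 < charge X v} = - real c * real (card {v\<in>A. \<not> 0 < charge X v})"
  proof -
    have "sum (charge X) {v\<in>A. \<not> 0 < charge X v} = (\<Sum>v\<in>{v\<in>A. \<not> 0 < charge X v}. - real c)"
      using assms(2,3) by (intro sum.cong) fastforce+
    then show ?thesis by simp
  qed
  have "sum (charge X) A = sum (charge X) {v\<in>A. 0 < charge X v} + sum (charge X) {v\<in>A. \<not> 0 < charge X v}"
    using sum.union_disjoint[of "{v\<in>A. 0 < charge X v}" "{v\<in>A. \<not> 0 < charge X v}" "charge X"] assms(1)
    by (auto simp: Un_def conj_disj_distribL[symmetric] intro: arg_cong[where f = "sum _"])
  then show "sum (charge X) A = real c * (real (card {v\<in>A. 0 < charge X v}) - real (card {v\<in>A. \<not> 0 < charge X v}))"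
    unfolding pos neg by (simp add: algebra_simps)
  show "sum (charge X) (positive_part X A) = real c * real (card {v\<in>A. 0 < charge X v})"
    using pos unfolding positive_part_def .
qed

lemma abs_total_energy_le:
  assumes "C \<subseteq> ions X" "finite (ions X)"
  shows "\<bar>total_energy F X C\<bar> \<le>
    (\<Sum>(i, j)\<in>{(i, j). i \<in> ions X \<and> j \<in> ions X \<and> i < j}. \<bar>pair_energy F X i j\<bar>)"
proof -
  have "\<bar>total_energy F X C\<bar> \<le> (\<Sum>(i, j)\<in>{(i, j). i \<in> C \<and> j \<in> C \<and> i < j}. \<bar>pair_energy F X i j\<bar>)"
    unfolding total_energy_def by (rule order_trans[OF sum_abs]) (auto intro!: sum_mono)
  also have "\<dots> \<le> (\<Sum>(i, j)\<in>{(i, j). i \<in> ions X \<and> j \<in> ions X \<and> i < j}. \<bar>pair_energy F X i j\<bar>)"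
    using assms by (intro sum_mono2 pairs_finite) auto
  finally show ?thesis .
qed

text \<open>Complementation matches the two sides: \<open>R\<close> consists of \<open>m\<close>
  ions of each sign, and the clique is the remaining \<open>r\<close> of each sign.\<close>

lemma charge_removal_iff_clique:
  assumes X: "crystal_graph X" "neutral X (ions X)"
    and c: "\<forall>v\<in>ions X. charge X v = real c \<or> charge X v = - real c"
    and M: "\<bar>g\<bar> + (\<Sum>(i, j)\<in>{(i, j). i \<in> ions X \<and> j \<in> ions X \<and> i < j}. \<bar>pair_energy F X i j\<bar>) < M"
    and k: "k = m * c" and r: "m + r = card {v\<in>ions X. 0 < charge X v}"
  shows "(\<exists>R. k_charges X k R \<and> total_energy F X (ions X - R) \<le> g) \<longleftrightarrow>
    (\<exists>C. clique (ion_graph F X M) C \<and> card C = 2 * r \<and>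
       M * real (r * r) - g \<le> clique_weight (ion_graph F X M) C)"
proof -
  let ?V = "ions X"
  define pos where "pos = (\<lambda>A. card {v\<in>A. 0 < charge X v})"
  define neg where "neg = (\<lambda>A. card {v\<in>A. \<not> 0 < charge X v})"
  have fin: "finite ?V" and nz: "\<forall>v\<in>?V. charge X v \<noteq> 0"
    using X(1) by (auto simp: crystal_graph_def)
  have card: "card A = pos A + neg A" if "A \<subseteq> ?V" for A
  proof -
    have "finite A" using that fin by (rule finite_subset)
    then show ?thesis unfolding pos_def neg_def
      by (subst card_Un_disjoint[symmetric]) (auto intro: arg_cong[where f = card])
  qed
  have diff: "pos (?V - A) + pos A = pos ?V" "neg (?V - A) + neg A = neg ?V" if "A \<subseteq> ?V" for A
  proof -
    have A: "finite A" "finite (?V - A)" using that fin by (auto intro: finite_subset)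
    show "pos (?V - A) + pos A = pos ?V" unfolding pos_def using that A
      by (subst card_Un_disjoint[symmetric]) (auto intro: arg_cong[where f = card])
    show "neg (?V - A) + neg A = neg ?V" unfolding neg_def using that A
      by (subst card_Un_disjoint[symmetric]) (auto intro: arg_cong[where f = card])
  qed
  \<comment> \<open>Charges are nonzero, so \<open>c = 0\<close> forces the empty crystal. This case
    is separated because cardinalities are obtained below by cancelling \<open>c\<close>.\<close>
  have c0: "?V = {}" if "c = 0"
    using c nz that by fastforce
  have k_charges: "k_charges X k R \<longleftrightarrow> R \<subseteq> ?V \<and> pos R = m \<and> neg R = m" for R
  proof (cases "R \<subseteq> ?V")
    case True
    then have "finite R" using fin by (rule finite_subset)
    then have sums: "sum (charge X) R = real c * (real (pos R) - real (neg R))"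
      "sum (charge X) (positive_part X R) = real c * real (pos R)"
      unfolding pos_def neg_def using True c nz by (intro sum_charge; blast)+
    show ?thesis
    proof (cases "c = 0")
      case True
      then have "?V = {}" by (rule c0)
      then have "m = 0" "R = {}" using r \<open>R \<subseteq> ?V\<close> by auto
      then show ?thesis by (simp add: k_charges_def neutral_def positive_part_def pos_def neg_def k)
    next
      case False
      have "real c * real (pos R) = real k \<longleftrightarrow> pos R = m"
        using False unfolding k by (simp add: mult.commute)
      then show ?thesis
        using True False unfolding k_charges_def neutral_def sums by auto
    qed
  qed (auto simp: k_charges_def)
  have posV: "pos ?V = m + r" using r by (simp add: pos_def)
  have negV: "neg ?V = m + r"
  proof (cases "c = 0")
    case True
    then have "?V = {}" by (rule c0)
    then show ?thesis using r by (simp add: neg_def)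
  next
    case False
    have "real c * (real (pos ?V) - real (neg ?V)) = 0"
      using X(2) sum_charge(1)[OF fin c nz] by (simp add: neutral_def pos_def neg_def)
    then show ?thesis using False posV by simp
  qed
  have weight: "clique_weight (ion_graph F X M) C = M * real (pos C * neg C) - total_energy F X C"
    if "C \<subseteq> ?V" for C
    using clique_weight_ion_graph[OF that fin] by (simp add: pos_def neg_def)
  show ?thesis
  proof
    assume "\<exists>R. k_charges X k R \<and> total_energy F X (?V - R) \<le> g"
    then obtain R where R: "R \<subseteq> ?V" "pos R = m" "neg R = m" "total_energy F X (?V - R) \<le> g"
      using k_charges by auto
    then have "pos (?V - R) = r" "neg (?V - R) = r"
      using diff[OF R(1)] posV negV by auto
    then have "card (?V - R) = 2 * r"
      "M * real (r * r) - g \<le> clique_weight (ion_graph F X M) (?V - R)"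
      using card[of "?V - R"] weight[of "?V - R"] R(4) by auto
    moreover have "clique (ion_graph F X M) (?V - R)" by (auto simp: clique_ion_graph)
    ultimately show "\<exists>C. clique (ion_graph F X M) C \<and> card C = 2 * r \<and>
       M * real (r * r) - g \<le> clique_weight (ion_graph F X M) C" by blast
  next
    assume "\<exists>C. clique (ion_graph F X M) C \<and> card C = 2 * r \<and>
       M * real (r * r) - g \<le> clique_weight (ion_graph F X M) C"
    then obtain C where C: "C \<subseteq> ?V" "pos C + neg C = 2 * r"
      "M * real (r * r) - g \<le> M * real (pos C * neg C) - total_energy F X C"
      using card weight by (auto simp: clique_ion_graph)
    have "\<bar>g\<bar> + \<bar>total_energy F X C\<bar> < M"
      using abs_total_energy_le[OF C(1) fin, of F] M by linarith
    \<comment> \<open>The gap between \<open>g\<close> and any energy is smaller than one bonus, so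
      it cannot make up for a missing opposite pair.\<close>
    then have less: "g - total_energy F X C < M" and M0: "0 \<le> M" by linarith+
    have "pos C = neg C"
    proof (rule ccontr)
      assume "pos C \<noteq> neg C"
      then have "pos C * neg C + 1 \<le> r * r" by (rule unbalanced_product[OF C(2)])
      then have "real (pos C * neg C) + 1 \<le> real (r * r)"
        by (metis of_nat_1 of_nat_add of_nat_le_iff)
      then have "M * (real (pos C * neg C) + 1) \<le> M * real (r * r)"
        using M0 by (intro mult_left_mono)
      then have "M \<le> g - total_energy F X C" using C(3) by (simp add: distrib_left)
      then show False using less by linarith
    qed
    then have eq: "pos C = r" "neg C = r" using C(2) by auto
    then have "total_energy F X C \<le> g" using C(3) by simp
    moreover have "?V - (?V - C) = C" using C(1) by auto
    moreover have "k_charges X k (?V - C)"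
      using diff[OF C(1)] eq posV negV by (auto simp: k_charges)
    ultimately show "\<exists>R. k_charges X k R \<and> total_energy F X (?V - R) \<le> g" by metis
  qed
qed


subsection \<open>Decoding\<close>

text \<open>Factors a coding through concrete data: \<open>enc\<close> leads from data to trees, and
  \<open>R\<close> says which objects a datum denotes. Programs are analysed on the data, their
  meaning through \<open>R\<close>.\<close>

definition represents :: "'a coding \<Rightarrow> ('z::enc \<Rightarrow> 'a \<Rightarrow> bool) \<Rightarrow> bool" where
  "represents A R \<longleftrightarrow> (\<forall>d x. A d x \<longleftrightarrow> (\<exists>z. d = enc z \<and> R z x))"

definition frac_rel :: "fraction \<Rightarrow> real \<Rightarrow> bool" where
  "frac_rel z x \<longleftrightarrow> 0 < snd z \<and> x = frac_val z"

definition point_rel :: "point \<Rightarrow> real ^ 3 \<Rightarrow> bool" where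
  "point_rel z p \<longleftrightarrow> frac_rel (fst z) (p $ 1) \<and> frac_rel (fst (snd z)) (p $ 2) \<and> frac_rel (snd (snd z)) (p $ 3)"

lemma represents_nat: "represents nat_code (=)"
  by (simp add: represents_def nat_code_def enc_nat_def)

lemma represents_real: "represents real_code frac_rel"
proof -
  have "real_code d x \<longleftrightarrow> (\<exists>a b. d = enc (a, b) \<and> frac_rel (a, b) x)" for d x
    by (auto simp: real_code_def frac_rel_def frac_val_def enc_nat_def enc_int_def)
  then show ?thesis by (simp add: represents_def split_paired_Ex)
qed

lemma represents_pair:
  "represents A R \<Longrightarrow> represents B S \<Longrightarrow> represents (pair_code A B) (rel_prod R S)"
proof -
  assume "represents A R" "represents B S"
  then have "pair_code A B d x \<longleftrightarrow> (\<exists>a b. d = enc (a, b) \<and> rel_prod R S (a, b) x)" for d x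
    by (auto simp: represents_def pair_code_def rel_prod_sel)
  then show ?thesis by (simp add: represents_def split_paired_Ex)
qed

lemma represents_list:
  assumes "represents A R" shows "represents (list_code A) (list_all2 R)"
proof -
  have "list_code A d xs \<longleftrightarrow> (\<exists>zs. d = enc zs \<and> list_all2 R zs xs)" for d xs
  proof (induction xs arbitrary: d)
    case (Cons x xs)
    have "list_code A d (x # xs) \<longleftrightarrow> (\<exists>z zs. d = Node (enc z) (enc zs) \<and> R z x \<and> list_all2 R zs xs)"
      unfolding list_code.simps Cons.IH using assms unfolding represents_def by blast
    also have "\<dots> \<longleftrightarrow> (\<exists>zs. d = enc zs \<and> list_all2 R zs (x # xs))"
      unfolding list_all2_Cons2 by (metis enc_list.simps(2))
    finally show ?case .
  qed simp
  then show ?thesis by (simp add: represents_def)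
qed

lemma represents_point: "represents point_code point_rel"
proof -
  have "represents (pair_code real_code (pair_code real_code real_code)) (rel_prod frac_rel (rel_prod frac_rel frac_rel))"
    by (intro represents_pair represents_real)
  then show ?thesis
    by (auto simp: represents_def point_code_def point_rel_def rel_prod_sel)
qed

text \<open>The meaning of instance data in terms of the crystal, with the intermediate real-valued
  lists of \<open>crystal_code\<close> eliminated.\<close>

definition describes :: "instance_data \<Rightarrow> crystal \<Rightarrow> nat \<Rightarrow> real \<Rightarrow> bool" where
  "describes w X k g \<longleftrightarrow>
    (\<forall>v\<in>set (fst (fst w)). point_rel (ion_position v) (position X (fst v)) \<and>
       frac_rel (ion_charge v) (charge X (fst v)) \<and> ion_species v = species X (fst v)) \<and>
    distinct (map fst (fst (fst w))) \<and> ions X = fst ` set (fst (fst w)) \<and>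
    (\<forall>e\<in>set (snd (fst w)). list_all2 frac_rel (snd (snd e)) (params X {fst e, fst (snd e)})) \<and>
    (\<forall>i\<in>ions X. \<forall>j\<in>ions X. i \<noteq> j \<longrightarrow>
       (\<exists>e\<in>set (snd (fst w)). {fst e, fst (snd e)} = {species X i, species X j})) \<and>
    fst (snd w) = k \<and> frac_rel (snd (snd w)) g"

lemma list_all2_setD1: "list_all2 R xs ys \<Longrightarrow> x \<in> set xs \<Longrightarrow> \<exists>y\<in>set ys. R x y"
  by (induction rule: list_all2_induct) auto

lemma list_all2_setD2: "list_all2 R xs ys \<Longrightarrow> y \<in> set ys \<Longrightarrow> \<exists>x\<in>set xs. R x y"
  by (induction rule: list_all2_induct) auto

lemma charge_removal_code:
  assumes "pair_code crystal_code (pair_code nat_code real_code) d (X, k, g)"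
  obtains w where "d = enc w" "describes w X k g"
proof -
  let ?R = "rel_prod (=) (rel_prod point_rel (rel_prod frac_rel (=)))"
  let ?S = "rel_prod (=) (rel_prod (=) (list_all2 frac_rel))"
  obtain d1 d2 where d: "d = Node d1 d2" and d1: "crystal_code d1 X"
    and "pair_code nat_code real_code d2 (k, g)"
    using assms by (auto simp: pair_code_def)
  then obtain b where b: "d2 = enc b" "fst b = k" "frac_rel (snd b) g"
    using represents_pair[OF represents_nat represents_real] by (auto simp: represents_def rel_prod_sel)
  obtain vs ps where code: "pair_code
       (list_code (pair_code nat_code (pair_code point_code (pair_code real_code nat_code))))
       (list_code (pair_code nat_code (pair_code nat_code (list_code real_code)))) d1 (vs, ps)"
    and dist: "distinct (map fst vs)" and ions: "ions X = set (map fst vs)"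
    and vs: "\<forall>(v, p, q, s) \<in> set vs. position X v = p \<and> charge X v = q \<and> species X v = s"
    and ps: "\<forall>(s, t, \<theta>) \<in> set ps. params X {s, t} = \<theta>"
    and ex: "\<forall>i \<in> ions X. \<forall>j \<in> ions X. i \<noteq> j \<longrightarrow>
        (\<exists>(s, t, \<theta>) \<in> set ps. {s, t} = {species X i, species X j})"
    using d1 unfolding crystal_code_def by blast
  have "represents (pair_code
       (list_code (pair_code nat_code (pair_code point_code (pair_code real_code nat_code))))
       (list_code (pair_code nat_code (pair_code nat_code (list_code real_code)))))
       (rel_prod (list_all2 ?R) (list_all2 ?S))"
    by (intro represents_pair represents_list represents_nat represents_point represents_real)
  then obtain a where a: "d1 = enc a" "list_all2 ?R (fst a) vs" "list_all2 ?S (snd a) ps"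
    using code by (auto simp: represents_def rel_prod_sel)
  have names: "map fst (fst a) = map fst vs"
    using a(2) by (induction rule: list_all2_induct) (auto simp: rel_prod_sel)
  have "point_rel (ion_position v) (position X (fst v)) \<and>
       frac_rel (ion_charge v) (charge X (fst v)) \<and> ion_species v = species X (fst v)"
    if v: "v \<in> set (fst a)" for v
  proof -
    obtain v' where "v' \<in> set vs" "?R v v'" using list_all2_setD1[OF a(2) v] ..
    then show ?thesis using vs by (cases v') (auto simp: rel_prod_sel)
  qed
  moreover have "list_all2 frac_rel (snd (snd e)) (params X {fst e, fst (snd e)})"
    if e: "e \<in> set (snd a)" for e
  proof -
    obtain e' where "e' \<in> set ps" "?S e e'" using list_all2_setD1[OF a(3) e] ..
    then show ?thesis using ps by (cases e') (auto simp: rel_prod_sel)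
  qed
  moreover have "\<exists>e\<in>set (snd a). {fst e, fst (snd e)} = {species X i, species X j}"
    if "i \<in> ions X" "j \<in> ions X" "i \<noteq> j" for i j
  proof -
    have "\<exists>(s, t, \<theta>) \<in> set ps. {s, t} = {species X i, species X j}"
      using ex that by simp
    then obtain e' where e': "e' \<in> set ps" "{fst e', fst (snd e')} = {species X i, species X j}"
      by (force simp: case_prod_beta)
    from list_all2_setD2[OF a(3) e'(1)] obtain e where "e \<in> set (snd a)" "?S e e'" ..
    then show ?thesis using e'(2) by (intro bexI[of _ e]) (auto simp: rel_prod_sel)
  qed
  moreover have "ions X = fst ` set (fst a)" using ions names by (metis set_map)
  ultimately have "describes (a, b) X k g"
    using dist names b by (simp add: describes_def)
  moreover have "d = enc (a, b)" using d a b by simp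
  ultimately show ?thesis using that by blast
qed

lemma describes_well_formed: "describes w X k g \<Longrightarrow> well_formed w"
  unfolding describes_def well_formed_def point_rel_def
  using list_all2_setD1[where R = frac_rel] by (simp add: frac_rel_def) blast


subsection \<open>Correctness\<close>

text \<open>Only the value of the returned fraction is prescribed: equal real arguments given by
  different fractions may lead to different answers. The root undoes the coding of a distance by its
  square.\<close>

definition evaluates :: "(fraction list \<times> fraction \<Rightarrow> fraction) \<Rightarrow> energy_function \<Rightarrow> bool" where
  "evaluates f F \<longleftrightarrow>
    (\<forall>z\<in>energy_inputs. frac_rel (f z) (F (map frac_val (fst z)) (sqrt (frac_val (snd z)))))"

lemma polytime_computable_ptime:
  assumes "polytime_computable (pair_code (list_code real_code) distance_code) real_code
             (\<lambda>(\<theta>, r). F \<theta> r)"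
  obtains f where "ptime energy_inputs f" "evaluates f F"
proof -
  obtain P p where P: "\<And>d x. pair_code (list_code real_code) distance_code d x \<Longrightarrow>
      \<exists>t d'. halts_with P d t d' \<and> t \<le> poly p (tree_size d) \<and> real_code d' (case x of (\<theta>, r) \<Rightarrow> F \<theta> r)"
    using assms unfolding polytime_computable_def by blast
  have "\<exists>y. (\<exists>t. halts_with P (enc z) t (enc y) \<and> t \<le> poly p (sz z)) \<and>
      frac_rel y (F (map frac_val (fst z)) (sqrt (frac_val (snd z))))" if z: "z \<in> energy_inputs" for z
  proof -
    have "\<forall>a\<in>set (fst z). 0 < snd a" using z by (auto simp: energy_inputs_def)
    then have "list_all2 frac_rel (fst z) (map frac_val (fst z))"
      by (simp add: list_all2_map2 list.rel_refl_strong frac_rel_def list_all2_same)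
    then have "list_code real_code (enc (fst z)) (map frac_val (fst z))"
      using represents_list[OF represents_real] by (auto simp: represents_def)
    moreover have "distance_code (enc (snd z)) (sqrt (frac_val (snd z)))"
    proof -
      have "0 \<le> frac_val (snd z)" "0 < snd (snd z)"
        using z by (auto simp: energy_inputs_def frac_val_def)
      moreover from this have "real_code (enc (snd z)) (frac_val (snd z))"
        using represents_real unfolding represents_def frac_rel_def by blast
      ultimately show ?thesis by (simp add: distance_code_def)
    qed
    ultimately have "pair_code (list_code real_code) distance_code (enc z)
        (map frac_val (fst z), sqrt (frac_val (snd z)))"
      by (cases z) (auto simp: pair_code_def)
    from P[OF this] obtain t d' where "halts_with P (enc z) t d'" "t \<le> poly p (sz z)"
      "real_code d' (F (map frac_val (fst z)) (sqrt (frac_val (snd z))))" by auto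
    moreover from this(3) obtain y where "d' = enc y"
      "frac_rel y (F (map frac_val (fst z)) (sqrt (frac_val (snd z))))"
      using represents_real unfolding represents_def by blast
    ultimately show ?thesis by blast
  qed
  \<comment> \<open>By choice, \<open>f z\<close> is a fraction whose code the program outputs on
    the code of \<open>z\<close>.\<close>
  then obtain f where f: "\<And>z. z \<in> energy_inputs \<Longrightarrow>
      (\<exists>t. halts_with P (enc z) t (enc (f z)) \<and> t \<le> poly p (sz z)) \<and>
      frac_rel (f z) (F (map frac_val (fst z)) (sqrt (frac_val (snd z))))"
    by metis
  show ?thesis
  proof (rule that)
    show "ptime energy_inputs f" by (rule halts_ptime[of _ P f p]) (use f in blast)
    show "evaluates f F" using f by (simp add: evaluates_def)
  qed
qed

lemma sqrt_sqdist:
  assumes "point_rel p x" "point_rel q y"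
  shows "sqrt (frac_val (sqdist p q)) = dist x y"
proof -
  have "frac_val (sqdist p q) = (x $ 1 - y $ 1)\<^sup>2 + ((x $ 2 - y $ 2)\<^sup>2 + (x $ 3 - y $ 3)\<^sup>2)"
    using assms by (simp add: sqdist_def frac_add frac_sqdiff point_rel_def frac_rel_def)
  then show ?thesis
    by (simp add: dist_vec_def L2_set_def sum_3 dist_real_def)
qed

lemma ion_pairs_iff:
  "e \<in> set (ion_pairs vs) \<longleftrightarrow> fst e \<in> set vs \<and> snd e \<in> set vs \<and> fst (fst e) < fst (snd e)"
  by (cases e) (auto simp: ion_pairs_def)

lemma energy_eval:
  assumes f: "evaluates f F" and w: "describes w X k g"
    and e: "e \<in> set (ion_pairs (fst (fst w)))"
  shows "frac_rel (f (energy_input (snd (fst w)) e)) (pair_energy F X (fst (fst e)) (fst (snd e)))"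
proof -
  let ?z = "energy_input (snd (fst w)) e"
  let ?s = "ion_species (fst e)" and ?t = "ion_species (snd e)"
  have e': "fst e \<in> set (fst (fst w))" "snd e \<in> set (fst (fst w))" "fst (fst e) \<noteq> fst (snd e)"
    using e by (auto simp: ion_pairs_iff)
  then have species: "?s = species X (fst (fst e))" "?t = species X (fst (snd e))"
    and ions: "fst (fst e) \<in> ions X" "fst (snd e) \<in> ions X"
    using w by (auto simp: describes_def)
  \<comment> \<open>A valid code has an entry for the species of any two distinct ions, which
    excludes the default case of \<open>lookup\<close>.\<close>
  have "\<exists>a\<in>set (snd (fst w)). {fst a, fst (snd a)} = {?s, ?t}"
    using w ions e'(3) unfolding species describes_def by blast
  then obtain a where a: "a \<in> set (snd (fst w))" "{fst a, fst (snd a)} = {?s, ?t}"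
    "lookup (snd (fst w)) ?s ?t = snd (snd a)"
    using lookup_cases[of "snd (fst w)" ?s ?t] by blast
  moreover have "\<forall>e\<in>set (snd (fst w)). list_all2 frac_rel (snd (snd e)) (params X {fst e, fst (snd e)})"
    using w by (simp add: describes_def)
  ultimately have "list_all2 frac_rel (snd (snd a)) (params X {?s, ?t})"
    by fastforce
  then have "map frac_val (snd (snd a)) = params X {?s, ?t}"
    by (induction rule: list_all2_induct) (auto simp: frac_rel_def)
  then have "map frac_val (fst ?z) = params X {species X (fst (fst e)), species X (fst (snd e))}"
    using a species by (simp add: energy_input_def)
  moreover have "sqrt (frac_val (snd ?z)) = dist (position X (fst (fst e))) (position X (fst (snd e)))"
    using w e' by (auto simp: energy_input_def describes_def intro!: sqrt_sqdist)
  moreover have "?z \<in> energy_inputs"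
    using energy_input_in describes_well_formed[OF w] e by blast
  then have "frac_rel (f ?z) (F (map frac_val (fst ?z)) (sqrt (frac_val (snd ?z))))"
    using f by (simp add: evaluates_def)
  ultimately show ?thesis by (simp add: pair_energy_def)
qed

section \<open>From pairs of ion records to pairs of ion names\<close>

lemma distinct_ion_pairs: "distinct vs \<Longrightarrow> distinct (ion_pairs vs)"
  by (simp add: ion_pairs_def distinct_product)

text \<open>Ion names are distinct, so records are determined by names. This carries sums and edge
  sets from one kind of pair to the other.\<close>

lemma inj_on_ion_pairs:
  assumes "distinct (map fst vs)"
  shows "inj_on (\<lambda>e. (fst (fst e), fst (snd e))) (set (ion_pairs vs))"
proof (rule inj_onI)
  fix a b assume ab: "a \<in> set (ion_pairs vs)" "b \<in> set (ion_pairs vs)"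
    and eq: "(fst (fst a), fst (snd a)) = (fst (fst b), fst (snd b))"
  have "inj_on fst (set vs)" using assms by (simp add: distinct_map)
  then have "fst a = fst b" "snd a = snd b"
    using ab eq by (auto simp only: ion_pairs_iff prod.inject intro: inj_onD)
  then show "a = b" by (rule prod_eqI)
qed

lemma image_ion_pairs:
  "(\<lambda>e. (fst (fst e), fst (snd e))) ` set (ion_pairs vs) =
    {(i, j). i \<in> fst ` set vs \<and> j \<in> fst ` set vs \<and> i < j}"
proof (intro equalityI subsetI)
  fix p assume "p \<in> {(i, j). i \<in> fst ` set vs \<and> j \<in> fst ` set vs \<and> i < j}"
  then obtain v u where "v \<in> set vs" "u \<in> set vs" "p = (fst v, fst u)" "fst v < fst u"
    by (cases p) blast
  then show "p \<in> (\<lambda>e. (fst (fst e), fst (snd e))) ` set (ion_pairs vs)"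
    by (intro image_eqI[of _ _ "(v, u)"]) (simp_all add: ion_pairs_iff)
qed (auto simp: ion_pairs_iff)

lemma abs_frac_val_le: "0 < snd z \<Longrightarrow> \<bar>frac_val z\<bar> \<le> real (nat \<bar>fst z\<bar>)"
proof -
  assume "0 < snd z"
  then have "\<bar>real_of_int (fst z)\<bar> / real (snd z) \<le> \<bar>real_of_int (fst z)\<bar> / 1"
    by (intro divide_left_mono) auto
  then show ?thesis by (simp add: frac_val_def)
qed

text \<open>Strictness comes from the summand 1 in \<open>bonus\<close>; it rules out cliques that
  lack just one opposite pair.\<close>

lemma bonus_greater:
  assumes f: "evaluates f F" and w: "describes w X k g"
  shows "\<bar>g\<bar> + (\<Sum>(i, j)\<in>{(i, j). i \<in> ions X \<and> j \<in> ions X \<and> i < j}. \<bar>pair_energy F X i j\<bar>) <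
    real (bonus f w)"
proof -
  let ?ps = "ion_pairs (fst (fst w))" and ?a = "\<lambda>e. f (energy_input (snd (fst w)) e)"
  have dist: "distinct (map fst (fst (fst w)))" and ions: "ions X = fst ` set (fst (fst w))"
    using w by (auto simp: describes_def)
  have "(\<Sum>(i, j)\<in>{(i, j). i \<in> ions X \<and> j \<in> ions X \<and> i < j}. \<bar>pair_energy F X i j\<bar>) =
      (\<Sum>e\<in>set ?ps. \<bar>pair_energy F X (fst (fst e)) (fst (snd e))\<bar>)"
    unfolding ions image_ion_pairs[symmetric] sum.reindex[OF inj_on_ion_pairs[OF dist]] by simp
  also have "\<dots> \<le> (\<Sum>e\<in>set ?ps. real (nat \<bar>fst (?a e)\<bar>))"
    using energy_eval[OF f w] abs_frac_val_le by (intro sum_mono) (auto simp: frac_rel_def)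
  also have "\<dots> = real (sum_list (map (\<lambda>e. nat \<bar>fst (?a e)\<bar>) ?ps))"
    using distinct_ion_pairs dist by (simp add: sum_list_distinct_conv_sum_set distinct_map)
  moreover have "\<bar>g\<bar> \<le> real (nat \<bar>fst (snd (snd w))\<bar>)"
    using w abs_frac_val_le by (auto simp: describes_def frac_rel_def)
  ultimately show ?thesis
    unfolding bonus_def by simp
qed

lemma positive_iff:
  assumes "frac_rel q x" "x \<noteq> 0" shows "0 < x \<longleftrightarrow> \<not> fst q < 0"
  using assms by (auto simp: frac_rel_def frac_val_def zero_less_divide_iff)

lemma edge_entry_weight:
  assumes f: "evaluates f F" and w: "describes w X k g" and X: "crystal_graph X"
    and e: "e \<in> set (ion_pairs (fst (fst w)))"
  shows "frac_rel (snd (snd (edge_entry f w e)))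
    (ion_weight F X (real (bonus f w)) (fst (fst e)) (fst (snd e)))"
proof -
  let ?a = "f (energy_input (snd (fst w)) e)" and ?i = "fst (fst e)" and ?j = "fst (snd e)"
  have "frac_rel (ion_charge (fst e)) (charge X ?i)" "frac_rel (ion_charge (snd e)) (charge X ?j)"
    "charge X ?i \<noteq> 0" "charge X ?j \<noteq> 0"
    using w e X by (auto simp: describes_def ion_pairs_iff crystal_graph_def)
  from positive_iff[OF this(1,3)] positive_iff[OF this(2,4)]
  have opposite: "opposite X ?i ?j \<longleftrightarrow> \<not> (fst (ion_charge (fst e)) < 0 \<longleftrightarrow> fst (ion_charge (snd e)) < 0)"
    unfolding opposite_def by blast
  have "0 < snd ?a" "pair_energy F X ?i ?j = of_int (fst ?a) / of_nat (snd ?a)"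
    using energy_eval[OF f w e] by (simp_all add: frac_rel_def frac_val_def)
  then show ?thesis
    unfolding edge_entry_def opposite[symmetric]
    by (simp add: ion_weight_def frac_rel_def frac_val_def diff_divide_distrib)
qed

lemma graph_code_clique_instance:
  assumes f: "evaluates f F" and w: "describes w X k g" and X: "crystal_graph X"
  shows "graph_code (enc (map fst (fst (fst w)), map (edge_entry f w) (ion_pairs (fst (fst w)))))
    (ion_graph F X (real (bonus f w)))"
proof -
  let ?vs = "fst (fst w)" and ?G = "ion_graph F X (real (bonus f w))"
  let ?ps = "ion_pairs ?vs"
  let ?W = "\<lambda>e. ion_weight F X (real (bonus f w)) (fst (fst e)) (fst (snd e))"
  \<comment> \<open>The edge list with the real weights that the fractions in
    \<open>edge_entry\<close> denote.\<close>
  define es where "es = map (\<lambda>e. (fst (fst e), fst (snd e), ?W e)) ?ps"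
  have dist: "distinct (map fst ?vs)" and ions: "ions X = fst ` set ?vs"
    using w by (auto simp: describes_def)
  have "represents (pair_code nat_code (pair_code nat_code real_code)) (rel_prod (=) (rel_prod (=) frac_rel))"
    by (intro represents_pair represents_nat represents_real)
  moreover have "list_all2 (rel_prod (=) (rel_prod (=) frac_rel)) (map (edge_entry f w) ?ps) es"
    unfolding es_def list_all2_map1 list_all2_map2 list_all2_same
  proof
    fix e assume "e \<in> set ?ps"
    then have "frac_rel (snd (snd (edge_entry f w e))) (?W e)"
      by (rule edge_entry_weight[OF f w X])
    moreover have "fst (edge_entry f w e) = fst (fst e)" "fst (snd (edge_entry f w e)) = fst (snd e)"
      by (simp_all add: edge_entry_def)
    ultimately show "rel_prod (=) (rel_prod (=) frac_rel) (edge_entry f w e) (fst (fst e), fst (snd e), ?W e)"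
      by (simp add: rel_prod_sel)
  qed
  ultimately have "list_code (pair_code nat_code (pair_code nat_code real_code)) (enc (map (edge_entry f w) ?ps)) es"
    using represents_list unfolding represents_def by blast
  moreover have "list_code nat_code (enc (map fst ?vs)) (map fst ?vs)"
    using represents_list[OF represents_nat] by (auto simp: represents_def list.rel_eq)
  ultimately have "pair_code (list_code nat_code) (list_code (pair_code nat_code (pair_code nat_code real_code)))
     (enc (map fst ?vs, map (edge_entry f w) ?ps)) (map fst ?vs, es)"
    by (simp add: pair_code_def)
  moreover have "vertices ?G = set (map fst ?vs)" by (simp add: ion_graph_def ions)
  moreover have "distinct (map (\<lambda>(u, v, w). {u, v}) es)"
  proof -
    have "inj_on (\<lambda>e. {fst (fst e), fst (snd e)}) (set ?ps)"
    proof (rule inj_onI)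
      fix a b assume ab: "a \<in> set ?ps" "b \<in> set ?ps"
        and eq: "{fst (fst a), fst (snd a)} = {fst (fst b), fst (snd b)}"
      then have "(fst (fst a), fst (snd a)) = (fst (fst b), fst (snd b))"
        by (auto simp: doubleton_eq_iff ion_pairs_iff)
      then show "a = b" using inj_on_ion_pairs[OF dist] ab by (auto dest: inj_onD)
    qed
    moreover have "map (\<lambda>(u, v, w). {u, v}) es = map (\<lambda>e. {fst (fst e), fst (snd e)}) ?ps"
      by (simp add: es_def)
    moreover have "distinct ?ps" using dist distinct_ion_pairs by (simp add: distinct_map)
    ultimately show ?thesis by (simp add: distinct_map)
  qed
  moreover have "edges ?G = (\<lambda>(u, v, w). {u, v}) ` set es"
    unfolding ion_graph_def ions image_ion_pairs[symmetric] es_def by (simp add: image_image)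
  moreover have "\<forall>(u, v, w)\<in>set es. weight ?G {u, v} = w"
    by (auto simp: es_def ion_graph_def ion_pairs_iff)
  ultimately show ?thesis unfolding graph_code_def using dist by blast
qed

text \<open>The witness \<open>m\<close> counts the positive ions removed. For the last clause: as
  long as at least \<open>c\<close> remains, every positive ion is removed and none is kept, and a
  remainder below \<open>c\<close> never changes again.\<close>

lemma kept_fold:
  "\<exists>m. m + snd (fold (kept_step c) vs s) = length (filter (\<lambda>v. \<not> fst (ion_charge v) < 0) vs) + snd s \<and>
    fst s = m * c + fst (fold (kept_step c) vs s) \<and>
    (fst (fold (kept_step c) vs s) < c \<or> snd (fold (kept_step c) vs s) = snd s)"
proof (induction vs arbitrary: s)
  case (Cons v vs)
  obtain k n where s: "s = (k, n)" by (cases s)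
  let ?P = "\<lambda>v. \<not> fst (ion_charge v) < 0"
  obtain r l where rl: "fold (kept_step c) vs (kept_step c v s) = (r, l)" by fastforce
  obtain m where m: "m + l = length (filter ?P vs) + snd (kept_step c v s)"
    "fst (kept_step c v s) = m * c + r" "r < c \<or> l = snd (kept_step c v s)"
    using Cons.IH[of "kept_step c v s"] unfolding rl by auto
  have "\<exists>m. m + l = length (filter ?P (v # vs)) + n \<and> k = m * c + r \<and> (r < c \<or> l = n)"
  proof (cases "?P v \<and> c \<le> k")
    case True
    then have "kept_step c v s = (k - c, n)" by (simp add: kept_step_def s)
    then show ?thesis using m True by (intro exI[of _ "Suc m"]) auto
  next
    case False
    then have "kept_step c v s = (k, if ?P v then n + 1 else n)" by (auto simp: kept_step_def s)
    then show ?thesis using m False by (intro exI[of _ m]) (auto split: if_splits)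
  qed
  then show ?case using rl s by simp
qed simp

lemma kept:
  assumes w: "describes w X k g" and X: "crystal_graph X"
  obtains m where "m + snd (kept c w) = card {v\<in>ions X. 0 < charge X v}"
    "k = m * c + fst (kept c w)" "fst (kept c w) < c \<or> snd (kept c w) = 0"
proof -
  let ?vs = "fst (fst w)"
  let ?P = "\<lambda>v. \<not> fst (ion_charge v) < 0"
  have dist: "distinct (map fst ?vs)" and ions: "ions X = fst ` set ?vs"
    using w by (auto simp: describes_def)
  have "0 < charge X (fst v) \<longleftrightarrow> ?P v" if v: "v \<in> set ?vs" for v
  proof (rule positive_iff)
    show "frac_rel (ion_charge v) (charge X (fst v))" using v w unfolding describes_def by blast
    show "charge X (fst v) \<noteq> 0" using v X unfolding crystal_graph_def ions by blast
  qed
  then have "{v\<in>ions X. 0 < charge X v} = set (map fst (filter ?P ?vs))"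
    unfolding ions by auto
  moreover have "distinct (map fst (filter ?P ?vs))" using dist by (rule distinct_map_filter)
  ultimately have card: "card {v\<in>ions X. 0 < charge X v} = length (filter ?P ?vs)"
    using distinct_card[of "map fst (filter ?P ?vs)"] by simp
  have fold: "fold (kept_step c) ?vs (k, 0) = kept c w"
    using w by (simp add: describes_def kept_def)
  from kept_fold[of c ?vs "(k, 0)"] obtain m where
    "m + snd (kept c w) = length (filter ?P ?vs)" "k = m * c + fst (kept c w)"
    "fst (kept c w) < c \<or> snd (kept c w) = 0"
    unfolding fold fst_conv snd_conv add_0_right by blast
  then show ?thesis unfolding card[symmetric] by (rule that)
qed

text \<open>If \<open>R\<close> had n positive ions, then n * c = m * c + rest with rest > 0, so n >
  m. A rest below \<open>c\<close> is too small for a further multiple of \<open>c\<close>; and if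
  no positive ion is kept, there are only m of them.\<close>

lemma not_k_charges:
  assumes w: "describes w X k g" and X: "crystal_graph X"
    and c: "\<forall>v\<in>ions X. charge X v = real c \<or> charge X v = - real c"
    and nz: "fst (kept c w) \<noteq> 0"
  shows "\<not> k_charges X k R"
proof
  assume R: "k_charges X k R"
  obtain m where m: "m + snd (kept c w) = card {v\<in>ions X. 0 < charge X v}"
    "k = m * c + fst (kept c w)" "fst (kept c w) < c \<or> snd (kept c w) = 0"
    using w X by (rule kept)
  have fin: "finite (ions X)" using X by (simp add: crystal_graph_def)
  have RX: "R \<subseteq> ions X" using R by (simp add: k_charges_def)
  define n where "n = card {v\<in>R. 0 < charge X v}"
  have "n \<le> card {v\<in>ions X. 0 < charge X v}"
    unfolding n_def using RX fin by (intro card_mono) auto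
  then have n: "n \<le> m + snd (kept c w)" using m(1) by simp
  have "real c * real n = real k"
    using R sum_charge(2)[of R X c] RX fin c X
    by (auto simp: k_charges_def n_def crystal_graph_def finite_subset subset_iff)
  then have "n * c = k" by (metis mult.commute of_nat_eq_iff of_nat_mult)
  then have eq: "n * c = m * c + fst (kept c w)" using m(2) by simp
  have "m < n"
  proof (rule ccontr)
    assume "\<not> m < n"
    then have "n * c \<le> m * c" by (intro mult_le_mono1) simp
    then show False using eq nz by simp
  qed
  then have "Suc m * c \<le> n * c" by (intro mult_le_mono1) simp
  then show False using eq n \<open>m < n\<close> m(3) by auto
qed

theorem theorem14:
  fixes c :: nat and F :: energy_function
  assumes "polytime_computable (pair_code (list_code real_code) distance_code) real_code
             (\<lambda>(\<theta>, r). F \<theta> r)"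
  shows "polytime_reducible
           (restrict_problem (charge_removal F)
              (\<lambda>(X, k, g). \<forall>v \<in> ions X. charge X v = real c \<or> charge X v = - real c))
           max_weight_clique"
proof -
  obtain f where f: "ptime energy_inputs f" "evaluates f F"
    using assms by (rule polytime_computable_ptime)
  obtain P p where P: "\<And>w. w \<in> {w. well_formed w} \<Longrightarrow>
      \<exists>t. halts_with P (enc w) t (enc (clique_instance c f w)) \<and> t \<le> poly p (sz w)"
    using ptime_clique_instance[OF f(1)] by (rule ptime_halts) blast
  let ?A = "restrict_problem (charge_removal F)
    (\<lambda>(X, k, g). \<forall>v \<in> ions X. charge X v = real c \<or> charge X v = - real c)"
  have "\<exists>t d' y. halts_with P d t d' \<and> t \<le> poly p (tree_size d) \<and> y \<in> instances max_weight_clique \<and>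
      coding max_weight_clique d' y \<and> (yes ?A x \<longleftrightarrow> yes max_weight_clique y)"
    if x: "x \<in> instances ?A" "coding ?A d x" for d x
  proof -
    obtain X k g where xeq: "x = (X, k, g)" by (cases x)
    have X: "crystal_graph X" "neutral X (ions X)"
      and c: "\<forall>v \<in> ions X. charge X v = real c \<or> charge X v = - real c"
      and code: "pair_code crystal_code (pair_code nat_code real_code) d (X, k, g)"
      using x by (auto simp: xeq restrict_problem_def charge_removal_def)
    obtain w where d: "d = enc w" and w: "describes w X k g"
      using code by (rule charge_removal_code)
    obtain t where t: "halts_with P d t (enc (clique_instance c f w))" "t \<le> poly p (tree_size d)"
      using P[of w] describes_well_formed[OF w] d by auto
    have yesA: "yes ?A x \<longleftrightarrow> (\<exists>R. k_charges X k R \<and> total_energy F X (ions X - R) \<le> g)"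
      by (simp add: xeq restrict_problem_def charge_removal_def)
    have codeB: "coding max_weight_clique (enc (a, n, z)) (G, n, v)"
      if "graph_code (enc a) G" "frac_rel z v" for a :: "nat list \<times> (nat \<times> nat \<times> fraction) list" and n z G v
    proof -
      have "nat_code (enc n) n" "real_code (enc z) v"
        using represents_nat represents_real that(2) unfolding represents_def by blast+
      then show ?thesis using that(1) by (simp add: max_weight_clique_def pair_code_def)
    qed
    define r where "r = snd (kept c w)"
    show ?thesis
    proof (cases "fst (kept c w) = 0")
      case True
      define M where "M = bonus f w"
      define G where "G = ion_graph F X (real M)"
      let ?z = "(int (M * (r * r) * snd (snd (snd w))) - fst (snd (snd w)), snd (snd (snd w)))"
      have "frac_rel ?z (real M * real (r * r) - g)"
        using w by (auto simp: describes_def frac_rel_def frac_val_def diff_divide_distrib)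
      then have "coding max_weight_clique
          (enc ((map fst (fst (fst w)), map (edge_entry f w) (ion_pairs (fst (fst w)))), 2 * r, ?z))
          (G, 2 * r, real M * real (r * r) - g)"
        unfolding G_def M_def by (rule codeB[OF graph_code_clique_instance[OF f(2) w X(1)]])
      then have "coding max_weight_clique (enc (clique_instance c f w)) (G, 2 * r, real M * real (r * r) - g)"
        using True by (simp add: clique_instance_def r_def M_def)
      moreover have "(G, 2 * r, real M * real (r * r) - g) \<in> instances max_weight_clique"
        using graph_ion_graph X(1) by (simp add: max_weight_clique_def G_def crystal_graph_def)
      moreover have "yes ?A x \<longleftrightarrow> yes max_weight_clique (G, 2 * r, real M * real (r * r) - g)"
      proof -
        obtain m where m: "m + snd (kept c w) = card {v\<in>ions X. 0 < charge X v}"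
          "k = m * c + fst (kept c w)"
          using w X(1) by (rule kept)
        then have "m + r = card {v\<in>ions X. 0 < charge X v}" "k = m * c"
          using True by (simp_all add: r_def)
        from charge_removal_iff_clique[OF X c bonus_greater[OF f(2) w] this(2,1)]
        show ?thesis unfolding yesA by (simp add: max_weight_clique_def G_def M_def)
      qed
      ultimately show ?thesis using t by blast
    next
      case False
      define G where "G = \<lparr>vertices = {}, edges = {}, weight = (\<lambda>_. 0 :: real)\<rparr>"
      have "graph_code (enc ([] :: nat list, [] :: (nat \<times> nat \<times> fraction) list)) G"
        unfolding graph_code_def by (intro exI[of _ "[]"]) (simp add: pair_code_def G_def)
      moreover have "frac_rel (0, 1) 0" by (simp add: frac_rel_def frac_val_def)
      ultimately have "coding max_weight_clique (enc (clique_instance c f w)) (G, 1, 0)"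
        using codeB False unfolding clique_instance_def by (simp only: if_False)
      moreover have "(G, 1, 0) \<in> instances max_weight_clique"
        by (simp add: max_weight_clique_def G_def graph_def)
      moreover have "\<not> yes ?A x"
        using not_k_charges[OF w X(1) c False] yesA by blast
      moreover have "\<not> yes max_weight_clique (G, 1, 0)"
        by (auto simp: max_weight_clique_def G_def clique_def)
      ultimately show ?thesis using t by blast
    qed
  qed
  then show ?thesis unfolding polytime_reducible_def by blast
qed

end
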